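(* Let $f:[0,1]\to[0,1]$ be a continuous map which is topologically mixing and countably Markov, with a partition set $P$, and let $\Sigma$ be the topological Markov chain associated with the transition matrix $A(f,P)$. Then $$\log \Lambda(f) = h_{RevSal}(\Sigma) = \limsup_{n\to\infty} \frac1n \log \# f^{-n}(\{x\})$$ for every $x\in[0,1]\setminus \mathrm{Acc}(P)$.
   Context: For a continuous map $f:[0,1]\to[0,1]$, $\Lambda(f)$ is the infimum of all real $\lambda$ such that for some homeomorphism $\psi:[0,1]\to[0,1]$ the map $g=\psi\circ f\circ\psi^{-1}$ has Lipschitz constant $\lambda$, i.e. $|g(x)-g(y)|\le\lambda|x-y|$ for all $x,y\in[0,1]$ (the infimum of the empty set is $\infty$). $f$ is topologically mixing if for each pair of nonempty open sets $U,V\subset[0,1]$ there is $n_0\ge 0$ such that $f^n(U)\cap V\ne\emptyset$ for every $n\ge n_0$. $f$ is countably Markov if there is a closed, countable (possibly finite) set $P\subset[0,1]$ with $0,1\in P$, $f(P)\subset P$, and $f|_I$ monotone on each connected component $I$ of $[0,1]\setminus P$. Such a $P$ is called a partition set for $f$; $\mathcal B(P)$ is the set of components of $[0,1]\setminus P$, called partition intervals. $\mathrm{Acc}(P)$ is the set of accumulation points of $P$. The transition matrix $A=A(f,P)$ is the $0$-$1$ matrix indexed by $\mathcal B(P)$ with $A_{I,J}=1$ if $f(I)\supset J$ and $A_{I,J}=0$ if $f(I)\cap J=\emptyset$ (one of these always holds). For mixing $f$ it is irreducible. The associated topological Markov chain $\Sigma$ is the set of infinite sequences $I_0I_1I_2\cdots$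 in $\mathcal B(P)$ with $A_{I_k,I_{k+1}}=1$ for all $k\ge0$, with the shift map. Reverse Salama entropy: for a fixed $b\in\mathcal B(P)$, let $p^{(n)}_{\bullet b}=\sum_{a}(A^n)_{ab}$ be the number (possibly infinite) of paths $[i_0\cdots i_n]$ with $A_{i_k i_{k+1}}=1$ for $0\le k<n$ and $i_n=b$. Then $h_{RevSal}(\Sigma)=\limsup_{n\to\infty}\frac1n\log p^{(n)}_{\bullet b}$, which does not depend on the choice of $b$. Convention: $\log\infty=\infty$; $\#$ of an infinite set is $\infty$. *)

theory Defs
  imports "HOL-Analysis.Analysis"
begin

text \<open>
  Maps of the unit interval are functions on \<^typ>\<open>real\<close> of which only the values on
  \<^term>\<open>{0..1::real}\<close> matter.
\<close>

definition ln_ereal :: "ereal \<Rightarrow> ereal" where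
  "ln_ereal x = (if x = \<infinity> then \<infinity> else if x \<le> 0 then -\<infinity> else ereal (ln (real_of_ereal x)))"

definition ecard :: "'a set \<Rightarrow> enat" where
  "ecard X = (if finite X then enat (card X) else \<infinity>)"

text \<open>The infimum is taken in the extended reals, so it is \<open>\<infinity>\<close> when no conjugate is Lipschitz.\<close>

definition Lipschitz_inf :: "(real \<Rightarrow> real) \<Rightarrow> ereal" where
  "Lipschitz_inf f =
     Inf {ereal L |L. \<exists>\<psi> \<psi>' :: real \<Rightarrow> real. homeomorphism {0..1} {0..1} \<psi> \<psi>' \<and>
                        lipschitz_on L {0..1} (\<psi> \<circ> f \<circ> \<psi>')}"

definition topologically_mixing :: "(real \<Rightarrow> real) \<Rightarrow> bool" where
  "topologically_mixing f \<longleftrightarrow>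
     (\<forall>U V. openin (top_of_set {0..1}) U \<and> U \<noteq> {} \<and> openin (top_of_set {0..1}) V \<and> V \<noteq> {} \<longrightarrow>
        (\<exists>n0. \<forall>n\<ge>n0. (f ^^ n) ` U \<inter> V \<noteq> {}))"

definition partition_intervals :: "real set \<Rightarrow> real set set" where
  "partition_intervals P = components ({0..1} - P)"

definition partition_set :: "(real \<Rightarrow> real) \<Rightarrow> real set \<Rightarrow> bool" where
  "partition_set f P \<longleftrightarrow>
     closed P \<and> countable P \<and> P \<subseteq> {0..1} \<and> 0 \<in> P \<and> 1 \<in> P \<and> f ` P \<subseteq> P \<and>
     (\<forall>I\<in>partition_intervals P. mono_on I f \<or> antimono_on I f)"

definition countably_Markov :: "(real \<Rightarrow> real) \<Rightarrow> bool" where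
  "countably_Markov f \<longleftrightarrow> (\<exists>P. partition_set f P)"

text \<open>
  For a continuous self-map \<open>f\<close> of the interval with partition set \<open>P\<close>, and partition intervals
  \<open>I\<close>, \<open>J\<close>, if \<open>J\<close> is not contained in \<open>f ` I\<close> then it is disjoint from it.
\<close>

definition transition_matrix :: "(real \<Rightarrow> real) \<Rightarrow> real set \<Rightarrow> real set \<Rightarrow> nat" where
  "transition_matrix f I J = (if J \<subseteq> f ` I then 1 else 0)"

text \<open>
  A topological Markov chain is given by its countable set of states \<open>S\<close> and its 0-1 matrix \<open>A\<close>,
  of which only the entries indexed by \<open>S\<close> matter. The set \<open>paths_ending S A n b\<close> consists of the
  paths \<open>[i\<^sub>0, \<dots>, i\<^sub>n]\<close> in \<open>S\<close> with \<open>i\<^sub>n = b\<close>.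
\<close>

definition paths_ending :: "'a set \<Rightarrow> ('a \<Rightarrow> 'a \<Rightarrow> nat) \<Rightarrow> nat \<Rightarrow> 'a \<Rightarrow> 'a list set" where
  "paths_ending S A n b =
     {w. length w = Suc n \<and> set w \<subseteq> S \<and> (\<forall>k<n. A (w ! k) (w ! Suc k) = 1) \<and> w ! n = b}"

text \<open>
  Reverse Salama entropy computed at the final state \<open>b\<close>; for irreducible \<open>A\<close> it does not depend
  on \<open>b\<close>.
\<close>

definition rev_Salama_entropy :: "'a set \<Rightarrow> ('a \<Rightarrow> 'a \<Rightarrow> nat) \<Rightarrow> 'a \<Rightarrow> ereal" where
  "rev_Salama_entropy S A b =
     limsup (\<lambda>n. ereal (1 / real n) * ln_ereal (ereal_of_enat (ecard (paths_ending S A n b))))"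

end

theory Submission
  imports Defs
begin

text \<open>
  Strict monotonicity on partition intervals, a consequence of mixing, makes \<open>f ^^ n\<close> map each
  cylinder of a path from \<open>a\<close> to \<open>b\<close> bijectively onto \<open>b\<close>. If a conjugate of \<open>f\<close> has Lipschitz
  constant \<open>L\<close>, then in the new coordinate these disjoint cylinders have length at least a constant
  times \<open>L ^ -n\<close>, so there are at most \<open>C * L ^ n\<close> of them.

  Conversely, if \<open>L\<close> exceeds the exponential growth rate of the number \<open>p n\<close> of such paths, let
  \<open>V n t\<close> be the integral over \<open>z \<in> b\<close> of the number of preimages of \<open>z\<close> under \<open>f ^^ n\<close> in
  \<open>{0..t}\<close>. Then \<open>V n t \<le> p n\<close>, and the variation of \<open>V n\<close> between \<open>f s\<close> and \<open>f t\<close> is at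
  most that of \<open>V (Suc n)\<close> between \<open>s\<close> and \<open>t\<close>. Hence \<open>\<Sum>n. V n t / L ^ n\<close>, normalised, is a
  homeomorphism conjugating \<open>f\<close> to a map with Lipschitz constant \<open>L\<close>.

  So the growth rate equals \<open>ln \<Lambda>(f)\<close> for every \<open>b\<close>, which also shows that it is independent of
  \<open>b\<close>. Finally the preimages of \<open>x\<close> are compared with those of nearby points in the adjacent
  partition intervals.
\<close>

section \<open>Mixing maps and partition intervals\<close>

text \<open>\<open>closed_segment\<close> ignores the order of its endpoints, so increasing and
  decreasing behaviour need not be separated. Applied to continuous images, this is the form of the
  intermediate value theorem used throughout.\<close>

lemma connected_contains_closed_segment:
  fixes S :: "real set"
  assumes "connected S" "a \<in> S" "b \<in> S"
  shows "closed_segment a b \<subseteq> S"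
  using assms connected_contains_Icc[of S a b] connected_contains_Icc[of S b a]
  by (simp add: closed_segment_eq_real_ivl)

locale mixing_Markov_map =
  fixes f :: "real \<Rightarrow> real" and P :: "real set"
  assumes cont: "continuous_on {0..1} f"
    and maps: "f ` {0..1} \<subseteq> {0..1}"
    and mixing: "topologically_mixing f"
    and partition: "partition_set f P"
begin

lemma f_in_unit: "y \<in> {0..1} \<Longrightarrow> f y \<in> {0..1}"
  using maps by blast

lemma funpow_in_unit: "y \<in> {0..1} \<Longrightarrow> (f ^^ n) y \<in> {0..1}"
proof (induction n)
  case (Suc n)
  then show ?case using f_in_unit by simp
qed simp

lemma continuous_on_funpow: "continuous_on {0..1} (f ^^ n)"
proof (induction n)
  case (Suc n)
  have "continuous_on ((f ^^ n) ` {0..1}) f"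
    using cont funpow_in_unit by (meson continuous_on_subset image_subsetI)
  with Suc show ?case using continuous_on_compose[of "{0..1}" "f ^^ n" f] by (simp add: comp_def)
qed (simp add: continuous_on_id)

section \<open>Consequences of topological mixing\<close>

lemma mixing_interval:
  assumes "u < v" "{u<..<v} \<subseteq> {0..1}" "p < q" "{p<..<q} \<subseteq> {0..1}"
  shows "eventually (\<lambda>n. \<exists>y\<in>{u<..<v}. (f ^^ n) y \<in> {p<..<q}) sequentially"
proof -
  have "openin (top_of_set {0..1}) {u<..<v}" "openin (top_of_set {0..1}) {p<..<q}"
    using assms by (simp_all add: open_subset)
  moreover have "{u<..<v} \<noteq> {}" "{p<..<q} \<noteq> {}"
    using assms by auto
  ultimately obtain n0 where "\<forall>n\<ge>n0. (f ^^ n) ` {u<..<v} \<inter> {p<..<q} \<noteq> {}"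
    using mixing unfolding topologically_mixing_def by meson
  then have "\<forall>n\<ge>n0. \<exists>y\<in>{u<..<v}. (f ^^ n) y \<in> {p<..<q}"
    by blast
  then show ?thesis
    unfolding eventually_sequentially by blast
qed

text \<open>For large \<open>n\<close> the image meets both the left and the right half of
  \<open>{p<..<q}\<close>. Being connected, it contains the segment between the two points hit. The
  gain over mixing itself is a covered set of positive length.\<close>

lemma mixing_covers_subinterval:
  assumes "u < v" "{u<..<v} \<subseteq> {0..1}" "p < q" "{p<..<q} \<subseteq> {0..1}"
  shows "eventually (\<lambda>n. \<exists>c d. p < c \<and> c < d \<and> d < q \<and> {c..d} \<subseteq> (f ^^ n) ` {u<..<v}) sequentially"
proof -
  define m where "m = (p + q) / 2"
  have m: "p < m" "m < q" using \<open>p < q\<close> by (auto simp: m_def)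
  have "{p<..<m} \<subseteq> {p<..<q}" "{m<..<q} \<subseteq> {p<..<q}" using m by auto
  then have sub: "{p<..<m} \<subseteq> {0..1}" "{m<..<q} \<subseteq> {0..1}" using assms(4) by (meson subset_trans)+
  have "eventually (\<lambda>n. \<exists>y\<in>{u<..<v}. (f ^^ n) y \<in> {p<..<m}) sequentially"
    "eventually (\<lambda>n. \<exists>y\<in>{u<..<v}. (f ^^ n) y \<in> {m<..<q}) sequentially"
    using mixing_interval[OF assms(1,2) m(1)] mixing_interval[OF assms(1,2) m(2)] sub by blast+
  then show ?thesis
  proof eventually_elim
    case (elim n)
    then obtain y y' where y: "y \<in> {u<..<v}" "(f ^^ n) y \<in> {p<..<m}"
      "y' \<in> {u<..<v}" "(f ^^ n) y' \<in> {m<..<q}" by blast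
    have "connected ((f ^^ n) ` {u<..<v})"
      using assms(2) continuous_on_funpow continuous_on_subset
      by (blast intro: connected_continuous_image connected_Ioo)
    then have "{(f ^^ n) y..(f ^^ n) y'} \<subseteq> (f ^^ n) ` {u<..<v}"
      by (rule connected_contains_Icc) (use y in auto)
    moreover have "p < (f ^^ n) y" "(f ^^ n) y < (f ^^ n) y'" "(f ^^ n) y' < q"
      using y by auto
    ultimately show ?case by blast
  qed
qed

text \<open>If \<open>f ^^ n\<close> were constant on the interval, so would be
  \<open>f ^^ m\<close> for all \<open>m \<ge> n\<close>, but for large \<open>m\<close> the image
  contains a nondegenerate segment.\<close>

lemma funpow_not_constant:
  assumes "u < v" "{u<..<v} \<subseteq> {0..1}"
  shows "\<exists>y\<in>{u<..<v}. (f ^^ n) y \<noteq> c"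
proof (rule ccontr)
  assume "\<not> ?thesis"
  then have const: "(f ^^ n) y = c" if "y \<in> {u<..<v}" for y
    using that by blast
  have "eventually (\<lambda>m. \<exists>c d. 0 < c \<and> c < d \<and> d < 1 \<and> {c..d} \<subseteq> (f ^^ m) ` {u<..<v}) sequentially"
    using assms by (intro mixing_covers_subinterval) auto
  then obtain m where "m \<ge> n" "\<exists>c d. 0 < c \<and> c < d \<and> d < 1 \<and> {c..d} \<subseteq> (f ^^ m) ` {u<..<v}"
    unfolding eventually_sequentially by (meson nle_le)
  then obtain c' d' where cd: "c' < d'" "{c'..d'} \<subseteq> (f ^^ m) ` {u<..<v}"
    by blast
  have "(f ^^ m) y = (f ^^ (m - n)) c" if "y \<in> {u<..<v}" for y
    using const[OF that] \<open>m \<ge> n\<close> by (metis comp_apply funpow_add le_add_diff_inverse2)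
  then have "(f ^^ m) ` {u<..<v} \<subseteq> {(f ^^ (m - n)) c}"
    by blast
  then have "c' = (f ^^ (m - n)) c" "d' = (f ^^ (m - n)) c"
    using cd by (meson atLeastAtMost_iff less_imp_le order_refl singletonD subsetD)+
  with cd show False by simp
qed

text \<open>The image is compact, so a missed point of the open unit interval lies in a missed open
  interval. By mixing some orbit enters that interval at a positive time, which is
  impossible.\<close>

lemma f_surj: "f ` {0..1} = {0..1}"
proof (rule antisym[OF maps])
  have "compact (f ` {0..1})"
    using cont by (rule compact_continuous_image) simp
  then have closed: "closed (f ` {0..1})" by (rule compact_imp_closed)
  have "{0<..<1} \<subseteq> f ` {0..1}"
  proof (rule ccontr)
    assume "\<not> ?thesis"
    then have "{0<..<1} - f ` {0..1} \<noteq> {}" by blast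
    moreover have "open ({0<..<1} - f ` {0..1})" using closed by (simp add: open_Diff)
    ultimately obtain x e where x: "x \<in> {0<..<1} - f ` {0..1}" "e > 0"
      "ball x e \<subseteq> {0<..<1} - f ` {0..1}"
      by (meson ex_in_conv open_contains_ball)
    then have sub: "{x-e<..<x+e} \<subseteq> {0<..<1} - f ` {0..1}"
      by (simp add: ball_eq_greaterThanLessThan)
    have "eventually (\<lambda>n. \<exists>y\<in>{0<..<1}. (f ^^ n) y \<in> {x-e<..<x+e}) sequentially"
      using sub \<open>e > 0\<close> by (intro mixing_interval) force+
    \<comment> \<open>A positive time is needed to write the point in the gap as a value of
      \<open>f\<close>.\<close>
    then obtain n where "n \<ge> 1" "\<exists>y\<in>{0<..<1}. (f ^^ n) y \<in> {x-e<..<x+e}"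
      unfolding eventually_sequentially by (meson nle_le)
    then obtain y k where "y \<in> {0<..<1}" "(f ^^ Suc k) y \<in> {x-e<..<x+e}"
      by (metis Suc_le_D One_nat_def)
    then have "f ((f ^^ k) y) \<in> {x-e<..<x+e}" "(f ^^ k) y \<in> {0..1}"
      using funpow_in_unit[of y k] by auto
    with sub show False by blast
  qed
  then have "closure {0<..<1} \<subseteq> f ` {0..1}" using closed by (rule closure_minimal)
  then show "{0..1} \<subseteq> f ` {0..1}" by simp
qed

lemma funpow_surj: "(f ^^ n) ` {0..1} = {0..1}"
proof (induction n)
  case (Suc n)
  then show ?case using f_surj image_comp[of f "f ^^ n" "{0..1}"] by (simp add: comp_def)
qed simp

section \<open>Geometry of the partition intervals and monotonicity of \<open>f\<close> on
  them\<close>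

lemma partition_interval_Ioo:
  assumes "I \<in> partition_intervals P"
  obtains p q where "p < q" "I = {p<..<q}" "p \<in> P" "q \<in> P" "{p<..<q} \<inter> P = {}" "{p..q} \<subseteq> {0..1}"
proof -
  have P: "closed P" "P \<subseteq> {0..1}" "0 \<in> P" "1 \<in> P"
    using partition by (auto simp: partition_set_def)
  \<comment> \<open>Because 0 and 1 belong to \<open>P\<close>, the complement is open in the real
    line, and so are its components.\<close>
  have eq: "{0..1} - P = {0<..<1} - P"
    using P by (auto simp: order_le_less)
  have I: "I \<in> components ({0..1} - P)"
    using assms by (simp add: partition_intervals_def)
  have "open I"
    using P I unfolding eq by (metis open_Diff open_components open_greaterThanLessThan)
  have "connected I" "I \<noteq> {}" "I \<subseteq> {0..1} - P"
    using I by (auto simp: in_components_connected in_components_nonempty dest: in_components_subset)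
  then have bdd: "bdd_below I" "bdd_above I"
    by (auto intro!: bdd_belowI[of _ 0] bdd_aboveI[of _ 1])
  define p q where "p = Inf I" and "q = Sup I"
  have "I \<subseteq> {p..q}"
    using bdd by (auto simp: p_def q_def intro: cInf_lower cSup_upper)
  have notin: "p \<notin> I" "q \<notin> I"
  proof -
    show "p \<notin> I"
    proof
      assume "p \<in> I"
      then obtain e where "e > 0" "ball p e \<subseteq> I" using \<open>open I\<close> open_contains_ball by blast
      then have "p - e/2 \<in> I" by (auto simp: dist_real_def)
      then have "p - e/2 \<in> {p..q}" using \<open>I \<subseteq> {p..q}\<close> by blast
      with \<open>e > 0\<close> show False by simp
    qed
    show "q \<notin> I"
    proof
      assume "q \<in> I"
      then obtain e where "e > 0" "ball q e \<subseteq> I" using \<open>open I\<close> open_contains_ball by blast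
      then have "q + e/2 \<in> I" by (auto simp: dist_real_def)
      then have "q + e/2 \<in> {p..q}" using \<open>I \<subseteq> {p..q}\<close> by blast
      with \<open>e > 0\<close> show False by simp
    qed
  qed
  have cl: "p \<in> closure I" "q \<in> closure I"
    using bdd \<open>I \<noteq> {}\<close> by (auto simp: p_def q_def closure_contains_Inf closure_contains_Sup)
  have "{p<..<q} \<subseteq> I"
  proof
    fix t assume t: "t \<in> {p<..<q}"
    then obtain u v where "u \<in> I" "u < t" "v \<in> I" "t < v"
      using bdd \<open>I \<noteq> {}\<close> by (metis cInf_lessD greaterThanLessThan_iff less_cSupD p_def q_def)
    then show "t \<in> I"
      using \<open>connected I\<close> by (meson connectedD_interval less_imp_le)
  qed
  with \<open>I \<subseteq> {p..q}\<close> notin have Ieq: "I = {p<..<q}"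
    by (force simp: order_le_less)
  have "closure I \<subseteq> {0..1}"
    using \<open>I \<subseteq> {0..1} - P\<close> by (intro closure_minimal) auto
  \<comment> \<open>Adding a closure point outside \<open>P\<close> to \<open>I\<close> would keep
    it connected, so maximality of the component puts that point in \<open>I\<close>. Hence the
    endpoints, which are not in \<open>I\<close>, must lie in \<open>P\<close>.\<close>
  have "closure I \<inter> ({0..1} - P) \<subseteq> I"
  proof
    fix t assume t: "t \<in> closure I \<inter> ({0..1} - P)"
    have "connected (insert t I)"
      by (rule connected_intermediate_closure[OF \<open>connected I\<close>]) (use t closure_subset in auto)
    then have "insert t I \<subseteq> I"
      using t \<open>I \<noteq> {}\<close> \<open>I \<subseteq> {0..1} - P\<close> by (intro components_maximal[OF I]) auto
    then show "t \<in> I" by simp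
  qed
  with cl notin \<open>closure I \<subseteq> {0..1}\<close> have "p \<in> P" "q \<in> P" by auto
  moreover have "p < q" using \<open>I \<noteq> {}\<close> Ieq by auto
  moreover have "{p..q} \<subseteq> {0..1}" using \<open>p \<in> P\<close> \<open>q \<in> P\<close> P by auto
  ultimately show thesis
    using that Ieq \<open>I \<subseteq> {0..1} - P\<close> by blast
qed

text \<open>Equal values at two points would make the monotone \<open>f\<close> constant in between,
  which \<open>funpow_not_constant\<close> excludes with exponent 1.\<close>

lemma f_inj_on_partition_interval:
  assumes "I \<in> partition_intervals P"
  shows "inj_on f I"
proof (rule linorder_inj_onI)
  obtain p q where pq: "I = {p<..<q}" "{p..q} \<subseteq> {0..1}"
    using partition_interval_Ioo[OF assms] by metis
  fix u v assume uv: "u < v" "u \<in> I" "v \<in> I"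
  show "f u \<noteq> f v"
  proof
    assume eq: "f u = f v"
    have "f y = f u" if "y \<in> {u<..<v}" for y
    proof -
      have "y \<in> I" using that uv pq by auto
      moreover have "mono_on I f \<or> antimono_on I f"
        using partition assms by (simp add: partition_set_def)
      ultimately have "(f u \<le> f y \<and> f y \<le> f v) \<or> (f v \<le> f y \<and> f y \<le> f u)"
        using that uv by (auto simp: monotone_on_def)
      with eq show ?thesis by auto
    qed
    moreover have "\<exists>y\<in>{u<..<v}. (f ^^ 1) y \<noteq> f u"
      using uv pq by (intro funpow_not_constant) auto
    ultimately show False by auto
  qed
qed auto

lemma f_between:
  assumes "I \<in> partition_intervals P" "u \<in> I" "v \<in> I" "u \<le> y" "y \<le> v"
  shows "f y \<in> closed_segment (f u) (f v)"
proof -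
  obtain p q where pq: "I = {p<..<q}"
    using partition_interval_Ioo[OF assms(1)] by metis
  have "mono_on I f \<or> antimono_on I f"
    using partition assms by (simp add: partition_set_def)
  moreover have "y \<in> I" using assms pq by auto
  ultimately have "(f u \<le> f y \<and> f y \<le> f v) \<or> (f v \<le> f y \<and> f y \<le> f u)"
    using assms by (auto simp: monotone_on_def)
  then show ?thesis
    by (auto simp: closed_segment_eq_real_ivl)
qed

text \<open>The endpoints of \<open>I\<close> are mapped into \<open>P\<close>, hence outside
  \<open>J\<close>, while \<open>f u\<close> lies between their images. So the whole interval
  \<open>J\<close> lies strictly between these images and is covered. This is the dichotomy behind
  the transition matrix: an image that meets \<open>J\<close> contains it.\<close>

lemma f_covers:
  assumes I: "I \<in> partition_intervals P" and J: "J \<in> partition_intervals P"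
    and "u \<in> I" "f u \<in> J"
  shows "J \<subseteq> f ` I"
proof
  fix z assume "z \<in> J"
  obtain p q where pq: "p < q" "I = {p<..<q}" "p \<in> P" "q \<in> P" "{p..q} \<subseteq> {0..1}"
    using partition_interval_Ioo[OF I] by metis
  obtain r s where rs: "J = {r<..<s}" "{r<..<s} \<inter> P = {}"
    using partition_interval_Ioo[OF J] by metis
  have contpq: "continuous_on {p..q} f"
    using cont pq continuous_on_subset by blast
  have fP: "f p \<in> P" "f q \<in> P"
    using partition pq by (auto simp: partition_set_def)
  \<comment> \<open>Monotonicity is given on the open interval only, so the endpoints are approached
    by points of \<open>I\<close> on either side of \<open>u\<close>, and continuity passes the
    inequalities to the limit.\<close>
  have "f u \<in> closed_segment (f p) (f q)"
  proof -
    have u: "p < u" "u < q" using \<open>u \<in> I\<close> pq by auto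
    have div_le: "c / real (Suc k) \<le> c" if "c > 0" for c k
      using that by (simp add: field_simps)
    have lim: "(\<lambda>k. f (p + (u - p) / real (Suc k))) \<longlonglongrightarrow> f p"
      "(\<lambda>k. f (q - (q - u) / real (Suc k))) \<longlonglongrightarrow> f q"
    proof -
      have "(\<lambda>k. p + (u - p) * inverse (real (Suc k))) \<longlonglongrightarrow> p + (u - p) * 0"
        "(\<lambda>k. q - (q - u) * inverse (real (Suc k))) \<longlonglongrightarrow> q - (q - u) * 0"
        by (intro tendsto_intros LIMSEQ_inverse_real_of_nat)+
      then have lims: "(\<lambda>k. p + (u - p) / real (Suc k)) \<longlonglongrightarrow> p"
        "(\<lambda>k. q - (q - u) / real (Suc k)) \<longlonglongrightarrow> q"
        by (simp_all add: divide_inverse)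
      have "(u - p) / real (Suc k) \<le> u - p" "(q - u) / real (Suc k) \<le> q - u"
        "(u - p) / real (Suc k) \<ge> 0" "(q - u) / real (Suc k) \<ge> 0" for k
        using u by (auto intro!: div_le simp del: of_nat_Suc)
      then have "p + (u - p) / real (Suc k) \<in> {p..q}" "q - (q - u) / real (Suc k) \<in> {p..q}" for k
        using u by (smt (verit) atLeastAtMost_iff)+
      then show "(\<lambda>k. f (p + (u - p) / real (Suc k))) \<longlonglongrightarrow> f p"
        "(\<lambda>k. f (q - (q - u) / real (Suc k))) \<longlonglongrightarrow> f q"
        using lims pq by (auto intro!: continuous_on_tendsto_compose[OF contpq])
    qed
    have ineq: "min (f (p + (u - p) / real (Suc k))) (f (q - (q - u) / real (Suc k))) \<le> f u \<and>
       f u \<le> max (f (p + (u - p) / real (Suc k))) (f (q - (q - u) / real (Suc k)))" for k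
    proof -
      have b: "(u - p) / real (Suc k) \<le> u - p" "(q - u) / real (Suc k) \<le> q - u"
        "(u - p) / real (Suc k) > 0" "(q - u) / real (Suc k) > 0"
        using u by (auto intro!: div_le simp del: of_nat_Suc)
      have "f u \<in> closed_segment (f (p + (u - p) / real (Suc k))) (f (q - (q - u) / real (Suc k)))"
        using b pq u by (intro f_between[OF I]) (auto simp del: of_nat_Suc)
      then show ?thesis by (auto simp: closed_segment_eq_real_ivl split: if_splits)
    qed
    have "min (f p) (f q) \<le> f u"
      using ineq by (intro LIMSEQ_le_const2[OF tendsto_min[OF lim]]) auto
    moreover have "f u \<le> max (f p) (f q)"
      using ineq by (intro LIMSEQ_le_const[OF tendsto_max[OF lim]]) auto
    ultimately show ?thesis by (auto simp: closed_segment_eq_real_ivl)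
  qed
  moreover have "f p \<notin> J" "f q \<notin> J"
    using fP rs by auto
  \<comment> \<open>The interval \<open>J\<close> contains \<open>f u\<close> but neither endpoint
    image, so it cannot extend past either of them.\<close>
  ultimately have "z \<in> open_segment (f p) (f q)"
    using \<open>z \<in> J\<close> \<open>f u \<in> J\<close> unfolding rs open_segment_eq_real_ivl closed_segment_eq_real_ivl
    by (auto split: if_splits)
  then have "z \<in> closed_segment (f p) (f q)" "z \<noteq> f p" "z \<noteq> f q"
    by (auto simp: open_segment_def)
  moreover have "closed_segment (f p) (f q) \<subseteq> f ` {p..q}"
    using connected_continuous_image[OF contpq connected_Icc] pq
    by (intro connected_contains_closed_segment) auto
  ultimately obtain y where "y \<in> {p..q}" "z = f y" "y \<noteq> p" "y \<noteq> q"
    by blast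
  then show "z \<in> f ` I" using pq by auto
qed

end

section \<open>Paths and cylinders\<close>

context mixing_Markov_map
begin

abbreviation paths :: "nat \<Rightarrow> real set \<Rightarrow> real set list set" where
  "paths n b \<equiv> paths_ending (partition_intervals P) (transition_matrix f) n b"

abbreviation interval_of :: "real \<Rightarrow> real set" where
  "interval_of y \<equiv> connected_component_set ({0..1} - P) y"

text \<open>An entry is the empty set at a time when the orbit is in \<open>P\<close>. The lemmas
  below only concern points that lie in a partition interval at every time up to
  \<open>n\<close>.\<close>

definition itinerary :: "nat \<Rightarrow> real \<Rightarrow> real set list" where
  "itinerary n y = map (\<lambda>k. interval_of ((f ^^ k) y)) [0..<Suc n]"

definition cylinder :: "real set list \<Rightarrow> real set" where
  "cylinder w = {y \<in> {0..1}. \<forall>k<length w. (f ^^ k) y \<in> w ! k}"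

lemma cylinder_subset: "cylinder w \<subseteq> {0..1}"
  by (auto simp: cylinder_def)

lemma interval_of_unique:
  assumes "I \<in> partition_intervals P" "y \<in> I"
  shows "interval_of y = I"
proof -
  obtain x where "I = interval_of x"
    using assms(1) unfolding partition_intervals_def components_def by blast
  then show ?thesis using connected_component_eq assms(2) by blast
qed

lemma interval_of_in:
  assumes "y \<in> {0..1} - P"
  shows "interval_of y \<in> partition_intervals P" "y \<in> interval_of y"
  using assms by (auto simp: partition_intervals_def componentsI connected_component_refl)

lemma partition_interval_subset:
  "I \<in> partition_intervals P \<Longrightarrow> I \<subseteq> {0..1} - P"
  unfolding partition_intervals_def by (rule in_components_subset)

lemma funpow_P: "y \<in> P \<Longrightarrow> (f ^^ n) y \<in> P"
  using partition by (induction n) (auto simp: partition_set_def)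

text \<open>Forward invariance of \<open>P\<close> read backwards: an orbit outside \<open>P\<close>
  at time \<open>n\<close> has avoided it until then, so its itinerary up to \<open>n\<close>
  consists of partition intervals.\<close>

lemma funpow_notin_P:
  assumes "(f ^^ n) y \<notin> P" "k \<le> n"
  shows "(f ^^ k) y \<notin> P"
  using assms funpow_P[of "(f ^^ k) y" "n - k"]
  by (metis comp_apply funpow_add le_add_diff_inverse2)

lemma itinerary_path:
  assumes b: "b \<in> partition_intervals P" and y: "y \<in> {0..1}" "(f ^^ n) y \<in> b"
  shows "itinerary n y \<in> paths n b" "y \<in> cylinder (itinerary n y)"
proof -
  have notP: "(f ^^ k) y \<in> {0..1} - P" if "k \<le> n" for k
    using that y partition_interval_subset[OF b] funpow_notin_P[of n y k] funpow_in_unit[of y k]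
    by blast
  have nth: "itinerary n y ! k = interval_of ((f ^^ k) y)" if "k \<le> n" for k
    using that by (simp add: itinerary_def nth_append del: upt_Suc)
  have len: "length (itinerary n y) = Suc n" by (simp add: itinerary_def)
  have "set (itinerary n y) \<subseteq> partition_intervals P"
    using notP interval_of_in by (auto simp: in_set_conv_nth len nth less_Suc_eq_le)
  moreover have "transition_matrix f (itinerary n y ! k) (itinerary n y ! Suc k) = 1" if "k < n" for k
  proof -
    have "interval_of ((f ^^ Suc k) y) \<subseteq> f ` interval_of ((f ^^ k) y)"
      using that notP[of k] notP[of "Suc k"] interval_of_in[of "(f ^^ k) y"]
        interval_of_in[of "(f ^^ Suc k) y"]
      by (intro f_covers[where u = "(f ^^ k) y"]) auto
    then show ?thesis using that by (simp add: nth transition_matrix_def)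
  qed
  moreover have "itinerary n y ! n = b"
    using interval_of_unique[OF b y(2)] by (simp add: nth)
  ultimately show "itinerary n y \<in> paths n b"
    by (simp add: paths_ending_def len)
  show "y \<in> cylinder (itinerary n y)"
    using y notP interval_of_in(2) by (auto simp: cylinder_def len nth less_Suc_eq_le)
qed

lemma itinerary_cylinder:
  assumes "w \<in> paths n b" "y \<in> cylinder w"
  shows "itinerary n y = w"
proof (rule nth_equalityI)
  show len: "length (itinerary n y) = length w"
    using assms by (simp add: itinerary_def paths_ending_def)
  fix k assume k: "k < length (itinerary n y)"
  then have "w ! k \<in> partition_intervals P" "(f ^^ k) y \<in> w ! k"
    using assms len by (auto simp: paths_ending_def cylinder_def)
  then show "itinerary n y ! k = w ! k"
    using interval_of_unique k by (simp add: itinerary_def nth_append del: upt_Suc)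
qed

lemma cylinders_disjoint:
  assumes "w \<in> paths n b" "w' \<in> paths n b" "w \<noteq> w'"
  shows "cylinder w \<inter> cylinder w' = {}"
  using assms itinerary_cylinder by blast

text \<open>Induction by prepending a state \<open>a\<close>: the new cylinder is the part of
  \<open>a\<close> that \<open>f\<close> sends into the old one. There \<open>f\<close> is
  injective, it is onto because the transition from \<open>a\<close> is allowed, and monotonicity
  keeps the cylinder connected.\<close>

lemma cylinder_bij_connected:
  assumes b: "b \<in> partition_intervals P" and "w \<in> paths n b"
  shows "bij_betw (f ^^ n) (cylinder w) b \<and> connected (cylinder w)"
  using assms(2)
proof (induction n arbitrary: w)
  case 0
  then have "w = [b]" by (auto simp: paths_ending_def length_Suc_conv)
  then have "cylinder w = b"
    using partition_interval_subset[OF b] by (auto simp: cylinder_def)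
  moreover have "connected b"
    using b in_components_connected unfolding partition_intervals_def by blast
  ultimately show ?case by (simp add: bij_betw_def)
next
  case (Suc n)
  then obtain a w' where w: "w = a # w'" and len: "length w' = Suc n"
    by (auto simp: paths_ending_def length_Suc_conv)
  have "\<forall>k<n. transition_matrix f (w' ! k) (w' ! Suc k) = 1"
  proof (intro allI impI)
    fix k assume "k < n"
    then have "transition_matrix f (w ! Suc k) (w ! Suc (Suc k)) = 1"
      using Suc.prems unfolding paths_ending_def by blast
    then show "transition_matrix f (w' ! k) (w' ! Suc k) = 1"
      by (simp add: w)
  qed
  then have w': "w' \<in> paths n b"
    using Suc.prems len by (auto simp: paths_ending_def w)
  have a: "a \<in> partition_intervals P"
    using Suc.prems by (auto simp: paths_ending_def w)
  have "transition_matrix f (w ! 0) (w ! Suc 0) = 1"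
    using Suc.prems unfolding paths_ending_def by blast
  \<comment> \<open>This is where the path condition enters: the first state of \<open>w'\<close>,
    and with it the cylinder of \<open>w'\<close>, is covered by the image of
    \<open>a\<close>.\<close>
  then have "w' ! 0 \<subseteq> f ` a"
    by (simp add: transition_matrix_def w split: if_splits)
  moreover have "cylinder w' \<subseteq> w' ! 0"
    using len by (force simp: cylinder_def)
  ultimately have sub: "cylinder w' \<subseteq> f ` a" by blast
  have cyl: "cylinder w = {y \<in> a. f y \<in> cylinder w'}"
    using partition_interval_subset[OF a] f_in_unit
    by (auto simp: cylinder_def w All_less_Suc2 funpow_swap1 simp del: funpow.simps)
       (auto simp: funpow_Suc_right simp del: funpow.simps)
  have IH: "bij_betw (f ^^ n) (cylinder w') b" "connected (cylinder w')"
    using Suc.IH[OF w'] by auto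
  have "bij_betw f (cylinder w) (cylinder w')"
    unfolding bij_betw_def
  proof
    show "inj_on f (cylinder w)"
      using f_inj_on_partition_interval[OF a] by (rule inj_on_subset) (auto simp: cyl)
    show "f ` cylinder w = cylinder w'"
      using sub by (auto simp: cyl)
  qed
  then have "bij_betw (f ^^ Suc n) (cylinder w) b"
    unfolding funpow_Suc_right using IH(1) by (rule bij_betw_trans)
  moreover have "connected (cylinder w)"
    unfolding connected_iff_interval
  proof (intro ballI allI impI)
    fix u v y assume uv: "u \<in> cylinder w" "v \<in> cylinder w" "u \<le> y" "y \<le> v"
    obtain p q where "a = {p<..<q}" using partition_interval_Ioo[OF a] by metis
    then have "y \<in> a" using uv by (auto simp: cyl)
    have "f y \<in> closed_segment (f u) (f v)"
      using uv by (intro f_between[OF a]) (auto simp: cyl)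
    moreover have "closed_segment (f u) (f v) \<subseteq> cylinder w'"
      using uv IH(2) by (intro connected_contains_closed_segment) (auto simp: cyl)
    ultimately show "y \<in> cylinder w" using \<open>y \<in> a\<close> by (auto simp: cyl)
  qed
  ultimately show ?case by blast
qed

lemma cylinder_image:
  "b \<in> partition_intervals P \<Longrightarrow> w \<in> paths n b \<Longrightarrow> (f ^^ n) ` cylinder w = b"
  using cylinder_bij_connected by (simp add: bij_betw_def)

lemma cylinder_inj:
  "b \<in> partition_intervals P \<Longrightarrow> w \<in> paths n b \<Longrightarrow> inj_on (f ^^ n) (cylinder w)"
  using cylinder_bij_connected by (simp add: bij_betw_def)

text \<open>Each cylinder contains exactly one preimage of \<open>z\<close>, so preimages in
  \<open>T\<close> correspond to the paths whose cylinder has its preimage in \<open>T\<close>. The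
  set \<open>T\<close> is kept general for its later use with \<open>{0..t}\<close>.\<close>

lemma bij_betw_itinerary:
  assumes b: "b \<in> partition_intervals P" and "z \<in> b" "T \<subseteq> {0..1}"
  shows "bij_betw (itinerary n) {y \<in> T. (f ^^ n) y = z}
           {w \<in> paths n b. z \<in> (f ^^ n) ` (cylinder w \<inter> T)}"
  unfolding bij_betw_def
proof
  show "inj_on (itinerary n) {y \<in> T. (f ^^ n) y = z}"
  proof (rule inj_onI)
    fix y y' assume y: "y \<in> {y \<in> T. (f ^^ n) y = z}" and y': "y' \<in> {y \<in> T. (f ^^ n) y = z}"
      and eq: "itinerary n y = itinerary n y'"
    have unit: "y \<in> {0..1}" "y' \<in> {0..1}" and in_b: "(f ^^ n) y \<in> b" "(f ^^ n) y' \<in> b"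
      using y y' \<open>z \<in> b\<close> \<open>T \<subseteq> {0..1}\<close> by (simp_all add: subset_iff)
    note itinerary_path[OF b unit(1) in_b(1)]
    moreover have y'_cyl: "y' \<in> cylinder (itinerary n y)"
      using itinerary_path(2)[OF b unit(2) in_b(2)] eq by simp
    ultimately show "y = y'"
      using cylinder_inj[OF b, of "itinerary n y" n] y y' unfolding inj_on_def by simp
  qed
  show "itinerary n ` {y \<in> T. (f ^^ n) y = z} =
    {w \<in> paths n b. z \<in> (f ^^ n) ` (cylinder w \<inter> T)}" (is "?l = ?r")
  proof
    show "?l \<subseteq> ?r"
    proof
      fix w assume "w \<in> ?l"
      then obtain y where y: "w = itinerary n y" "y \<in> T" "(f ^^ n) y = z" by blast
      then have "y \<in> {0..1}" "(f ^^ n) y \<in> b" using \<open>z \<in> b\<close> \<open>T \<subseteq> {0..1}\<close> by auto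
      from itinerary_path[OF b this] y show "w \<in> ?r" by blast
    qed
    show "?r \<subseteq> ?l"
    proof
      fix w assume "w \<in> ?r"
      then obtain y where "w \<in> paths n b" "z = (f ^^ n) y" "y \<in> cylinder w" "y \<in> T" by blast
      then show "w \<in> ?l" using itinerary_cylinder by blast
    qed
  qed
qed

text \<open>Consequently all points of \<open>b\<close> have equally many preimages under
  \<open>f ^^ n\<close>.\<close>

lemma bij_betw_itinerary_paths:
  assumes b: "b \<in> partition_intervals P" and "z \<in> b"
  shows "bij_betw (itinerary n) {y \<in> {0..1}. (f ^^ n) y = z} (paths n b)"
proof -
  have "{w \<in> paths n b. z \<in> (f ^^ n) ` (cylinder w \<inter> {0..1})} = paths n b"
    using cylinder_image[OF b] \<open>z \<in> b\<close> cylinder_subset by (auto simp: Int_absorb2)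
  then show ?thesis
    using bij_betw_itinerary[OF assms, of "{0..1}" n] by simp
qed

lemma eventually_paths_nonempty:
  assumes b: "b \<in> partition_intervals P"
  shows "eventually (\<lambda>n. paths n b \<noteq> {}) sequentially"
proof -
  obtain p q where pq: "p < q" "b = {p<..<q}" "{p..q} \<subseteq> {0..1}"
    using partition_interval_Ioo[OF b] by metis
  have "eventually (\<lambda>n. \<exists>y\<in>{0<..<1}. (f ^^ n) y \<in> {p<..<q}) sequentially"
    using pq by (intro mixing_interval) force+
  then show ?thesis
  proof eventually_elim
    case (elim n)
    then obtain y where "y \<in> {0<..<1}" "(f ^^ n) y \<in> b" using pq by blast
    then show ?case using itinerary_path(1)[OF b, of y n] by auto
  qed
qed

section \<open>Paths counted by preimages of boundary points\<close>

lemma cylinder_closure_preimage: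
  assumes b: "b \<in> partition_intervals P" and w: "w \<in> paths n b" and "x \<in> closure b"
  shows "\<exists>e\<in>closure (cylinder w). e \<in> {0..1} \<and> (f ^^ n) e = x"
proof -
  have sub: "closure (cylinder w) \<subseteq> {0..1}"
    using cylinder_subset by (intro closure_minimal) auto
  then have "compact (closure (cylinder w))"
    by (meson bounded_closed_interval bounded_subset closed_closure compact_eq_bounded_closed)
  then have "compact ((f ^^ n) ` closure (cylinder w))"
    using continuous_on_funpow sub
    by (intro compact_continuous_image) (auto intro: continuous_on_subset)
  moreover have "b \<subseteq> (f ^^ n) ` closure (cylinder w)"
    using cylinder_image[OF b w] closure_subset by blast
  \<comment> \<open>The image of the compact closure is closed, so with \<open>b\<close> it contains
    \<open>closure b\<close>.\<close>
  ultimately have "closure b \<subseteq> (f ^^ n) ` closure (cylinder w)"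
    by (intro closure_minimal compact_imp_closed)
  then show ?thesis using \<open>x \<in> closure b\<close> sub by blast
qed

text \<open>A point of \<open>S\<close> closer to \<open>e\<close> than \<open>u\<close> is lies on
  the far side of \<open>u\<close> as seen from \<open>y\<close>, so \<open>u\<close> is between two
  points of \<open>S\<close>.\<close>

lemma connected_between_closure:
  fixes S :: "real set"
  assumes "connected S" "y \<in> S" "e \<in> closure S" "u \<in> open_segment y e"
  shows "u \<in> S"
proof -
  have "y \<noteq> e" using assms(4) by auto
  have "dist u e > 0" using assms(4) by (auto simp: open_segment_def)
  then obtain c where c: "c \<in> S" "dist c e < dist u e"
    using assms(3) closure_approachable by blast
  then have "u \<in> closed_segment y c"
    using assms(4) unfolding open_segment_eq_real_ivl closed_segment_eq_real_ivl
    by (auto simp: dist_real_def split: if_splits)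
  then show ?thesis
    using connected_contains_closed_segment[OF assms(1,2) c(1)] by blast
qed

text \<open>A preimage of \<open>x\<close> can be a boundary point of at most one cylinder on each of its sides.\<close>

lemma card_paths_le_preimages:
  assumes b: "b \<in> partition_intervals P" and x: "x \<in> closure b"
    and fin: "finite {y \<in> {0..1}. (f ^^ n) y = x}"
  shows "finite (paths n b) \<and> card (paths n b) \<le> 3 * card {y \<in> {0..1}. (f ^^ n) y = x}"
proof -
  obtain z where z: "z \<in> b" using partition_interval_Ioo[OF b] by (metis dense greaterThanLessThan_iff)
  have "\<forall>w\<in>paths n b. \<exists>y. y \<in> cylinder w \<and> (f ^^ n) y = z"
    using cylinder_image[OF b] z by (metis imageE)
  then obtain y where y: "\<And>w. w \<in> paths n b \<Longrightarrow> y w \<in> cylinder w \<and> (f ^^ n) (y w) = z"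
    by metis
  have "\<forall>w\<in>paths n b. \<exists>e. e \<in> closure (cylinder w) \<and> e \<in> {0..1} \<and> (f ^^ n) e = x"
    using cylinder_closure_preimage[OF b _ x] by blast
  then obtain e where e: "\<And>w. w \<in> paths n b \<Longrightarrow>
      e w \<in> closure (cylinder w) \<and> e w \<in> {0..1} \<and> (f ^^ n) (e w) = x"
    by metis
  \<comment> \<open>The cylinder of \<open>w\<close> contains everything strictly between
    \<open>y w\<close> and its boundary point \<open>e w\<close>, and \<open>y w'\<close> belongs to
    a disjoint cylinder.\<close>
  have separated: "y w' \<notin> open_segment (y w) (e w)"
    if "w \<in> paths n b" "w' \<in> paths n b" "w \<noteq> w'" for w w'
    using connected_between_closure[of "cylinder w" "y w" "e w" "y w'"] cylinders_disjoint[OF that]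
      cylinder_bij_connected[OF b that(1)] e[OF that(1)] y[OF that(1)] y[OF that(2)] by blast
  \<comment> \<open>If two paths shared the boundary point and the side, the nearer of
    \<open>y w\<close> and \<open>y w'\<close> would lie strictly between the other one and that
    point. The sign 0 stands for \<open>y w = e w\<close>; the three signs give the factor
    3.\<close>
  have "inj_on (\<lambda>w. (e w, sgn (y w - e w))) (paths n b)"
  proof (rule inj_onI, rule ccontr)
    fix w w' assume w: "w \<in> paths n b" "w' \<in> paths n b" "w \<noteq> w'"
      and eq: "(e w, sgn (y w - e w)) = (e w', sgn (y w' - e w'))"
    then have "y w \<noteq> y w'" using cylinders_disjoint[OF w] y by (metis disjoint_iff)
    then show False
      using eq separated[OF w] separated[OF w(2,1) w(3)[symmetric]]
      by (auto simp: sgn_if open_segment_eq_real_ivl split: if_splits)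
  qed
  moreover have "sgn t \<in> {-1, 0, 1}" for t :: real
    by (simp add: sgn_real_def)
  then have "(\<lambda>w. (e w, sgn (y w - e w))) ` paths n b \<subseteq> {y \<in> {0..1}. (f ^^ n) y = x} \<times> {-1, 0, 1}"
    using e by blast
  moreover have "finite ({y \<in> {0..1}. (f ^^ n) y = x} \<times> {-1, 0, 1::real})"
    using fin by simp
  ultimately have "finite (paths n b)"
    "card (paths n b) \<le> card ({y \<in> {0..1}. (f ^^ n) y = x} \<times> {-1, 0, 1::real})"
    by (auto intro: inj_on_finite card_inj_on_le)
  then show ?thesis by (simp add: card_cartesian_product)
qed

text \<open>In the coordinate \<psi> every cylinder contains two points that \<open>n\<close> steps
  carry to a fixed pair at distance \<open>c\<close>, so its length times \<open>L ^ n\<close> is at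
  least \<open>c\<close>. The cylinders are disjoint in an interval of length 1, which gives the
  constant \<open>1 / c\<close>.\<close>

lemma card_paths_le_Lipschitz:
  fixes \<psi> \<psi>' :: "real \<Rightarrow> real"
  assumes b: "b \<in> partition_intervals P" and hom: "homeomorphism {0..1} {0..1} \<psi> \<psi>'"
    and lip: "lipschitz_on L {0..1} (\<psi> \<circ> f \<circ> \<psi>')"
  shows "\<exists>C>0. \<forall>n. finite (paths n b) \<and> real (card (paths n b)) \<le> C * L ^ n"
proof -
  have "L \<ge> 0" using lip by (rule lipschitz_on_nonneg)
  have \<psi>_unit: "\<psi> y \<in> {0..1}" if "y \<in> {0..1}" for y
    using hom that by (auto simp: homeomorphism_def)
  have \<psi>_inv: "\<psi>' (\<psi> y) = y" if "y \<in> {0..1}" for y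
    using hom that by (auto simp: homeomorphism_def)
  have \<psi>_cont: "continuous_on {0..1} \<psi>" using hom by (simp add: homeomorphism_def)
  have expand: "\<bar>\<psi> ((f ^^ n) u) - \<psi> ((f ^^ n) v)\<bar> \<le> L ^ n * \<bar>\<psi> u - \<psi> v\<bar>"
    if "u \<in> {0..1}" "v \<in> {0..1}" for u v n
  proof (induction n)
    case (Suc n)
    have "\<bar>\<psi> (f ((f ^^ n) u)) - \<psi> (f ((f ^^ n) v))\<bar> \<le> L * \<bar>\<psi> ((f ^^ n) u) - \<psi> ((f ^^ n) v)\<bar>"
      using lipschitz_onD[OF lip \<psi>_unit \<psi>_unit, OF funpow_in_unit funpow_in_unit, OF that, of n n]
        \<psi>_inv[OF funpow_in_unit[OF that(1)], of n] \<psi>_inv[OF funpow_in_unit[OF that(2)], of n]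
      by (simp add: dist_real_def)
    also have "\<dots> \<le> L * (L ^ n * \<bar>\<psi> u - \<psi> v\<bar>)"
      using Suc \<open>L \<ge> 0\<close> by (rule mult_left_mono)
    finally show ?case by (simp add: mult.assoc)
  qed simp
  obtain z z' where z: "z \<in> b" "z' \<in> b" "z < z'"
  proof -
    obtain p q where pq: "p < q" "b = {p<..<q}" using partition_interval_Ioo[OF b] by metis
    then obtain z where "p < z" "z < q" using dense by blast
    then obtain z' where "z < z'" "z' < q" using dense by blast
    then show thesis using that[of z z'] \<open>p < z\<close> \<open>z < q\<close> pq by auto
  qed
  define c where "c = \<bar>\<psi> z - \<psi> z'\<bar>"
  have "\<psi> z \<noteq> \<psi> z'"
    using \<psi>_inv[of z] \<psi>_inv[of z'] z partition_interval_subset[OF b] by force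
  then have "c > 0" by (simp add: c_def)
  have unit_fm: "{0..1::real} \<in> fmeasurable lborel"
    by (rule fmeasurableI) auto
  have img: "\<psi> ` cylinder w \<subseteq> {0..1}" for w
    using \<psi>_unit cylinder_subset by blast
  have inj: "inj_on \<psi> {0..1}"
    using \<psi>_inv by (rule inj_on_inverseI)
  \<comment> \<open>Stated for finite subfamilies, because the finiteness of
    \<open>paths n b\<close> is part of the claim and follows from this uniform bound.\<close>
  have bound: "real (card W) * c \<le> L ^ n" if W: "finite W" "W \<subseteq> paths n b" for W n
  proof -
    have meas: "\<psi> ` cylinder w \<in> sets lborel" if "w \<in> W" for w
    proof -
      have "connected (\<psi> ` cylinder w)"
        using cylinder_bij_connected[OF b, of w n] that W cylinder_subset \<psi>_cont
        by (blast intro: connected_continuous_image continuous_on_subset)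
      then have "is_interval (\<psi> ` cylinder w)" by (simp add: is_interval_connected_1)
      then show ?thesis by (simp add: real_interval_borel_measurable)
    qed
    have fm: "\<psi> ` cylinder w \<in> fmeasurable lborel" if "w \<in> W" for w
      by (rule fmeasurableI2[OF unit_fm img]) (use meas[OF that] in simp)
    \<comment> \<open>Multiplied out instead of divided by \<open>L ^ n\<close>: at this stage
      \<open>L = 0\<close> is not excluded, and its later exclusion rests on this lemma.\<close>
    have len: "c \<le> L ^ n * measure lborel (\<psi> ` cylinder w)" if "w \<in> W" for w
    proof -
      have w: "w \<in> paths n b" using that W by blast
      obtain y y' where y: "y \<in> cylinder w" "(f ^^ n) y = z" "y' \<in> cylinder w" "(f ^^ n) y' = z'"
        using cylinder_image[OF b w] z by (metis imageE)
      have "connected (\<psi> ` cylinder w)"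
        using cylinder_bij_connected[OF b w] cylinder_subset \<psi>_cont
        by (blast intro: connected_continuous_image continuous_on_subset)
      then have "closed_segment (\<psi> y) (\<psi> y') \<subseteq> \<psi> ` cylinder w"
        using y by (intro connected_contains_closed_segment) auto
      then have "measure lborel (closed_segment (\<psi> y) (\<psi> y')) \<le> measure lborel (\<psi> ` cylinder w)"
        using fm[OF that] by (intro measure_mono_fmeasurable) (auto simp: closed_segment_eq_real_ivl)
      then have "\<bar>\<psi> y - \<psi> y'\<bar> \<le> measure lborel (\<psi> ` cylinder w)"
        by (auto simp: closed_segment_eq_real_ivl split: if_splits)
      then have "L ^ n * \<bar>\<psi> y - \<psi> y'\<bar> \<le> L ^ n * measure lborel (\<psi> ` cylinder w)"
        using \<open>L \<ge> 0\<close> by (simp add: mult_left_mono)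
      moreover have "c \<le> L ^ n * \<bar>\<psi> y - \<psi> y'\<bar>"
        using expand[of y y' n] y subsetD[OF cylinder_subset] by (simp add: c_def)
      ultimately show ?thesis by linarith
    qed
    have "disjoint_family_on (\<lambda>w. \<psi> ` cylinder w) W"
      unfolding disjoint_family_on_def
    proof (intro ballI impI)
      fix w w' assume ww: "w \<in> W" "w' \<in> W" "w \<noteq> w'"
      have "\<psi> ` (cylinder w \<inter> cylinder w') = \<psi> ` cylinder w \<inter> \<psi> ` cylinder w'"
        by (rule inj_on_image_Int[OF inj cylinder_subset cylinder_subset])
      moreover have "cylinder w \<inter> cylinder w' = {}"
        using ww W by (intro cylinders_disjoint) auto
      ultimately show "\<psi> ` cylinder w \<inter> \<psi> ` cylinder w' = {}" by simp
    qed
    moreover have "emeasure lborel (\<psi> ` cylinder w) \<noteq> \<infinity>" if "w \<in> W" for w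
      using fmeasurableD2[OF fm[OF that]] by simp
    ultimately have "(\<Sum>w\<in>W. measure lborel (\<psi> ` cylinder w)) = measure lborel (\<Union>w\<in>W. \<psi> ` cylinder w)"
      using W meas by (intro measure_finite_Union[symmetric]) auto
    also have "\<dots> \<le> measure lborel {0..1::real}"
    proof (rule measure_mono_fmeasurable[OF _ _ unit_fm])
      show "(\<Union>w\<in>W. \<psi> ` cylinder w) \<subseteq> {0..1}" using img by (rule UN_least)
      show "(\<Union>w\<in>W. \<psi> ` cylinder w) \<in> sets lborel" using W(1) meas by (rule sets.finite_UN)
    qed
    finally have "(\<Sum>w\<in>W. measure lborel (\<psi> ` cylinder w)) \<le> 1" by simp
    then have "L ^ n * (\<Sum>w\<in>W. measure lborel (\<psi> ` cylinder w)) \<le> L ^ n"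
      using \<open>L \<ge> 0\<close> by (simp add: mult_left_le)
    moreover have "(\<Sum>w\<in>W. c) \<le> (\<Sum>w\<in>W. L ^ n * measure lborel (\<psi> ` cylinder w))"
      using len by (rule sum_mono)
    ultimately show ?thesis by (simp add: sum_distrib_left)
  qed
  have "finite (paths n b)" for n
  proof (rule finite_if_finite_subsets_card_bdd[THEN conjunct1])
    fix W assume W: "W \<subseteq> paths n b" "finite W"
    have "real (card W) \<le> L ^ n / c"
      using bound[OF W(2,1)] \<open>c > 0\<close> by (simp add: field_simps)
    then show "card W \<le> nat \<lfloor>L ^ n / c\<rfloor>" by (simp add: le_nat_floor)
  qed
  then show ?thesis
    using bound \<open>c > 0\<close> by (intro exI[of _ "1 / c"]) (auto simp: field_simps)
qed

end

section \<open>Construction of a Lipschitz conjugate\<close>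

context mixing_Markov_map
begin

text \<open>\<open>card\<close> is 0 on infinite sets. This does no harm, since the counts are only
  used for \<open>z\<close> in \<open>b\<close>, where finitely many paths mean finitely many
  preimages.\<close>

definition preimage_count :: "nat \<Rightarrow> real \<Rightarrow> real \<Rightarrow> real" where
  "preimage_count n t z = real (card {y \<in> {0..t}. (f ^^ n) y = z})"

text \<open>
  By Banach's indicatrix theorem this is the total variation on \<open>[0, t]\<close> of \<open>f ^^ n\<close> truncated
  to the interval \<open>b\<close>.
\<close>

definition truncated_variation :: "real set \<Rightarrow> nat \<Rightarrow> real \<Rightarrow> real" where
  "truncated_variation b n t = (\<integral>z. indicator b z * preimage_count n t z \<partial>lborel)"

lemma partition_interval_measure:
  assumes "b \<in> partition_intervals P"
  shows "b \<in> sets borel" "emeasure lborel b < \<infinity>" "measure lborel b \<le> 1"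
proof -
  obtain p q where "p < q" "b = {p<..<q}" "{p..q} \<subseteq> {0..1}"
    using partition_interval_Ioo[OF assms] by metis
  then show "b \<in> sets borel" "emeasure lborel b < \<infinity>" "measure lborel b \<le> 1"
    by auto
qed

section \<open>Integrated preimage counts over a partition interval with finite path counts\<close>

context
  fixes b :: "real set"
  assumes b: "b \<in> partition_intervals P" and fin: "\<And>n. finite (paths n b)"
begin

lemma finite_preimages:
  assumes "z \<in> b"
  shows "finite {y \<in> {0..1}. (f ^^ n) y = z}"
  using bij_betw_finite[OF bij_betw_itinerary_paths[OF b assms]] fin by blast

lemma finite_preimages_subset:
  assumes "z \<in> b" "T \<subseteq> {0..1}"
  shows "finite {y \<in> T. (f ^^ n) y = z}"
  by (rule finite_subset[OF _ finite_preimages[OF assms(1), of n]]) (use assms in blast)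

lemma preimage_count_le:
  assumes "t \<in> {0..1}" "z \<in> b"
  shows "preimage_count n t z \<le> card (paths n b)"
proof -
  have "card {y \<in> {0..t}. (f ^^ n) y = z} \<le> card {y \<in> {0..1}. (f ^^ n) y = z}"
    by (rule card_mono[OF finite_preimages[OF assms(2)]]) (use assms(1) in auto)
  then show ?thesis
    using bij_betw_same_card[OF bij_betw_itinerary_paths[OF b assms(2)], of n]
    by (simp add: preimage_count_def)
qed

text \<open>Increments are themselves counts, over a half-open interval. Monotonicity in
  \<open>t\<close> and all later comparisons of increments come from this.\<close>

lemma preimage_count_diff:
  assumes "s \<in> {0..1}" "t \<in> {0..1}" "s \<le> t" "z \<in> b"
  shows "preimage_count n t z - preimage_count n s z = card {y \<in> {s<..t}. (f ^^ n) y = z}"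
proof -
  have "{y \<in> {0..t}. (f ^^ n) y = z} = {y \<in> {0..s}. (f ^^ n) y = z} \<union> {y \<in> {s<..t}. (f ^^ n) y = z}"
    using assms by auto
  moreover have "card ({y \<in> {0..s}. (f ^^ n) y = z} \<union> {y \<in> {s<..t}. (f ^^ n) y = z})
      = card {y \<in> {0..s}. (f ^^ n) y = z} + card {y \<in> {s<..t}. (f ^^ n) y = z}"
    using assms by (intro card_Un_disjoint finite_preimages_subset) auto
  ultimately show ?thesis by (simp add: preimage_count_def)
qed

text \<open>Serves measurability: the images on the right are intervals, as continuous images of
  connected sets, and the sum is finite.\<close>

lemma preimage_count_eq_sum:
  assumes "t \<in> {0..1}"
  shows "indicator b z * preimage_count n t z =
    (\<Sum>w\<in>paths n b. indicator ((f ^^ n) ` (cylinder w \<inter> {0..t})) z)"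
proof (cases "z \<in> b")
  case True
  have "preimage_count n t z = card {w \<in> paths n b. z \<in> (f ^^ n) ` (cylinder w \<inter> {0..t})}"
    using bij_betw_same_card[OF bij_betw_itinerary[OF b True, of "{0..t}" n]] assms
    by (simp add: preimage_count_def)
  also have "\<dots> = (\<Sum>w\<in>paths n b. indicator ((f ^^ n) ` (cylinder w \<inter> {0..t})) z)"
    using fin[of n] by (simp add: indicator_def sum.If_cases Int_def)
  finally show ?thesis using True by simp
next
  case False
  have "indicator ((f ^^ n) ` (cylinder w \<inter> {0..t})) z = (0::real)" if "w \<in> paths n b" for w
    using cylinder_image[OF b that] False by (auto simp: indicator_def)
  then show ?thesis using False by simp
qed

lemma preimage_count_measurable:
  assumes "t \<in> {0..1}"
  shows "(\<lambda>z. indicator b z * preimage_count n t z) \<in> borel_measurable lborel"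
  unfolding preimage_count_eq_sum[OF assms]
proof (intro borel_measurable_sum borel_measurable_indicator)
  fix w assume w: "w \<in> paths n b"
  have "is_interval (cylinder w \<inter> {0..t})"
    using cylinder_bij_connected[OF b w] is_interval_connected_1 by (intro is_interval_Int) auto
  then have "connected (cylinder w \<inter> {0..t})" by (rule is_interval_connected)
  moreover have "continuous_on (cylinder w \<inter> {0..t}) (f ^^ n)"
    by (rule continuous_on_subset[OF continuous_on_funpow]) (use cylinder_subset in blast)
  ultimately have "connected ((f ^^ n) ` (cylinder w \<inter> {0..t}))"
    by (intro connected_continuous_image)
  then have "is_interval ((f ^^ n) ` (cylinder w \<inter> {0..t}))"
    by (simp add: is_interval_connected_1)
  then show "(f ^^ n) ` (cylinder w \<inter> {0..t}) \<in> sets lborel"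
    by (simp add: real_interval_borel_measurable)
qed

lemma integrable_bound_fun: "integrable lborel (\<lambda>z. indicator b z * real (card (paths n b)))"
  using partition_interval_measure[OF b] by (intro integrable_mult_left) (simp add: integrable_indicator_iff)

lemma norm_preimage_count_le:
  assumes "t \<in> {0..1}"
  shows "norm (indicator b z * preimage_count n t z) \<le> indicator b z * real (card (paths n b))"
  using preimage_count_le[OF assms, of z n] by (auto simp: indicator_def preimage_count_def)

lemma preimage_count_integrable:
  assumes "t \<in> {0..1}"
  shows "integrable lborel (\<lambda>z. indicator b z * preimage_count n t z)"
proof (rule Bochner_Integration.integrable_bound[OF integrable_bound_fun preimage_count_measurable[OF assms]])
  have "norm (indicator b z * preimage_count n t z) \<le> norm (indicator b z * real (card (paths n b)))" for z
    using norm_preimage_count_le[OF assms, of z n] by simp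
  then show "AE z in lborel. norm (indicator b z * preimage_count n t z)
      \<le> norm (indicator b z * real (card (paths n b)))" by simp
qed

lemma truncated_variation_bounds:
  assumes "t \<in> {0..1}"
  shows "0 \<le> truncated_variation b n t" "truncated_variation b n t \<le> card (paths n b)"
proof -
  show "0 \<le> truncated_variation b n t"
    unfolding truncated_variation_def
    by (intro Bochner_Integration.integral_nonneg) (simp add: preimage_count_def)
  have "truncated_variation b n t \<le> (\<integral>z. indicator b z * real (card (paths n b)) \<partial>lborel)"
    unfolding truncated_variation_def
    using norm_preimage_count_le[OF assms, of _ n]
    by (intro integral_mono preimage_count_integrable[OF assms] integrable_bound_fun)
      (simp add: preimage_count_def)
  also have "\<dots> = measure lborel b * real (card (paths n b))"
    using partition_interval_measure[OF b] by simp
  also have "\<dots> \<le> 1 * real (card (paths n b))"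
    using partition_interval_measure(3)[OF b] by (intro mult_right_mono) auto
  finally show "truncated_variation b n t \<le> card (paths n b)" by simp
qed

lemma truncated_variation_diff:
  assumes "s \<in> {0..1}" "t \<in> {0..1}"
  shows "truncated_variation b n t - truncated_variation b n s =
    (\<integral>z. indicator b z * preimage_count n t z - indicator b z * preimage_count n s z \<partial>lborel)"
  unfolding truncated_variation_def
  by (intro Bochner_Integration.integral_diff[symmetric] preimage_count_integrable assms)

text \<open>Dominated convergence: if \<open>a\<close> is not a preimage of \<open>z\<close>, the
  finitely many preimages of \<open>z\<close> keep a positive distance from \<open>a\<close>, so the
  count up to \<open>x k\<close> is eventually the count up to \<open>a\<close>. Only the null set
  consisting of \<open>(f ^^ n) a\<close> is left out.\<close>

lemma truncated_variation_continuous: "continuous_on {0..1} (truncated_variation b n)"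
  unfolding continuous_on_sequentially comp_def
proof (intro ballI allI impI, elim conjE)
  fix a :: real and x :: "nat \<Rightarrow> real" assume a: "a \<in> {0..1}" and "\<forall>k. x k \<in> {0..1}" and lim: "x \<longlonglongrightarrow> a"
  then have x: "x k \<in> {0..1}" for k by blast
  show "(\<lambda>k. truncated_variation b n (x k)) \<longlonglongrightarrow> truncated_variation b n a"
    unfolding truncated_variation_def
  proof (rule integral_dominated_convergence[where w = "\<lambda>z. indicator b z * real (card (paths n b))"])
    show "AE z in lborel. (\<lambda>k. indicator b z * preimage_count n (x k) z)
        \<longlonglongrightarrow> indicator b z * preimage_count n a z"
      using AE_lborel_singleton[of "(f ^^ n) a"]
    proof eventually_elim
      case (elim z)
      show ?case
      proof (cases "z \<in> b")
        case True
        obtain d where d: "d > 0" "\<And>y. y \<in> {0..1} \<Longrightarrow> (f ^^ n) y = z \<Longrightarrow> y \<noteq> a \<Longrightarrow> d \<le> dist a y"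
          using finite_set_avoid[OF finite_preimages[OF True, of n], of a] by auto
        have "eventually (\<lambda>k. dist (x k) a < d) sequentially"
          using lim \<open>d > 0\<close> by (rule tendstoD)
        then have "eventually (\<lambda>k. indicator b z * preimage_count n (x k) z
            = indicator b z * preimage_count n a z) sequentially"
        proof eventually_elim
          case (elim k)
          have "y \<le> x k \<longleftrightarrow> y \<le> a" if "y \<in> {0..1}" "(f ^^ n) y = z" for y
          proof -
            have "y \<noteq> a" using that \<open>z \<noteq> (f ^^ n) a\<close> by auto
            then show ?thesis using d(2)[OF that] elim by (auto simp: dist_real_def)
          qed
          then have "{y \<in> {0..x k}. (f ^^ n) y = z} = {y \<in> {0..a}. (f ^^ n) y = z}"
            using a x[of k] by (intro Collect_cong) (metis atLeastAtMost_iff order_trans)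
          then show ?case by (simp add: preimage_count_def)
        qed
        then show ?thesis by (rule tendsto_eventually)
      qed simp
    qed
    show "AE z in lborel. norm (indicator b z * preimage_count n (x k) z)
        \<le> indicator b z * real (card (paths n b))" for k
      using norm_preimage_count_le[OF x] by simp
  qed (use preimage_count_measurable a x integrable_bound_fun in auto)
qed

text \<open>
  A preimage of \<open>z\<close> under \<open>f ^^ n\<close> between \<open>f s\<close> and \<open>f t\<close> lifts by the intermediate value theorem
  to a preimage of \<open>z\<close> under \<open>f ^^ Suc n\<close> between \<open>s\<close> and \<open>t\<close>.
\<close>

lemma truncated_variation_image_le:
  assumes s: "s \<in> {0..1}" and t: "t \<in> {0..1}" and st: "s \<le> t"
  shows "\<bar>truncated_variation b n (f t) - truncated_variation b n (f s)\<bar>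
    \<le> truncated_variation b (Suc n) t - truncated_variation b (Suc n) s"
proof -
  have fs: "f s \<in> {0..1}" and ft: "f t \<in> {0..1}" using s t f_in_unit by auto
  have pointwise: "\<bar>preimage_count n (f t) z - preimage_count n (f s) z\<bar>
      \<le> preimage_count (Suc n) t z - preimage_count (Suc n) s z"
    \<comment> \<open>The excluded value has measure zero. Excluding it prevents a lifted preimage
      from being \<open>s\<close>, which the half-open interval \<open>{s<..t}\<close> does not
      contain.\<close>
    if z: "z \<in> b" "z \<noteq> (f ^^ n) (f s)" for z
  proof -
    \<comment> \<open>\<open>f\<close> may reverse the order of \<open>s\<close> and
      \<open>t\<close>.\<close>
    define lo hi where "lo = min (f s) (f t)" and "hi = max (f s) (f t)"
    have lohi: "lo \<in> {0..1}" "hi \<in> {0..1}" "lo \<le> hi" using fs ft by (auto simp: lo_def hi_def)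
    have "preimage_count n lo z \<le> preimage_count n hi z"
      using preimage_count_diff[OF lohi z(1), of n] by simp
    then have "\<bar>preimage_count n (f t) z - preimage_count n (f s) z\<bar> =
        preimage_count n hi z - preimage_count n lo z"
      by (auto simp: lo_def hi_def min_def max_def)
    also have "\<dots> = card {y \<in> {lo<..hi}. (f ^^ n) y = z}"
      using preimage_count_diff[OF lohi z(1)] .
    also have "card {y \<in> {lo<..hi}. (f ^^ n) y = z} \<le> card {y \<in> {s<..t}. (f ^^ Suc n) y = z}"
    proof (rule surj_card_le)
      show "finite {y \<in> {s<..t}. (f ^^ Suc n) y = z}"
        using s t z(1) by (intro finite_preimages_subset) auto
      show "{y \<in> {lo<..hi}. (f ^^ n) y = z} \<subseteq> f ` {y \<in> {s<..t}. (f ^^ Suc n) y = z}"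
      proof clarify
        fix y assume y: "y \<in> {lo<..hi}" "z = (f ^^ n) y"
        have "connected (f ` {s..t})"
          by (intro connected_continuous_image continuous_on_subset[OF cont]) (use s t in auto)
        then have "closed_segment (f s) (f t) \<subseteq> f ` {s..t}"
          using st by (intro connected_contains_closed_segment) auto
        moreover have "y \<in> closed_segment (f s) (f t)"
          using y by (auto simp: lo_def hi_def closed_segment_eq_real_ivl min_def max_def)
        ultimately obtain y' where y': "y' \<in> {s..t}" "y = f y'" by blast
        have "y' \<noteq> s" using z(2) y(2) y'(2) by auto
        then show "y \<in> f ` {u \<in> {s<..t}. (f ^^ Suc n) u = (f ^^ n) y}"
          using y' by (auto simp: funpow_Suc_right simp del: funpow.simps)
      qed
    qed
    finally show ?thesis
      using preimage_count_diff[OF s t st z(1), of "Suc n"] by simp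
  qed
  have "\<bar>truncated_variation b n (f t) - truncated_variation b n (f s)\<bar> \<le>
    (\<integral>z. \<bar>indicator b z * preimage_count n (f t) z - indicator b z * preimage_count n (f s) z\<bar> \<partial>lborel)"
    unfolding truncated_variation_diff[OF fs ft] by (rule integral_abs_bound)
  also have "\<dots> \<le> (\<integral>z. indicator b z * preimage_count (Suc n) t z
      - indicator b z * preimage_count (Suc n) s z \<partial>lborel)"
  proof (rule integral_mono_AE)
    show "AE z in lborel. \<bar>indicator b z * preimage_count n (f t) z
        - indicator b z * preimage_count n (f s) z\<bar>
      \<le> indicator b z * preimage_count (Suc n) t z - indicator b z * preimage_count (Suc n) s z"
      using AE_lborel_singleton[of "(f ^^ n) (f s)"]
    proof eventually_elim
      case (elim z)
      then show ?case using pointwise[of z] by (cases "z \<in> b") auto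
    qed
  qed (intro integrable_abs Bochner_Integration.integrable_diff preimage_count_integrable fs ft s t)+
  also have "\<dots> = truncated_variation b (Suc n) t - truncated_variation b (Suc n) s"
    using truncated_variation_diff[OF s t] by simp
  finally show ?thesis .
qed

lemma truncated_variation_mono:
  assumes s: "s \<in> {0..1}" and t: "t \<in> {0..1}" and st: "s \<le> t"
  shows "truncated_variation b n s \<le> truncated_variation b n t"
  unfolding truncated_variation_def
proof (intro integral_mono preimage_count_integrable s t)
  fix z show "indicator b z * preimage_count n s z \<le> indicator b z * preimage_count n t z"
    using preimage_count_diff[OF s t st, of z n] by (cases "z \<in> b") auto
qed

text \<open>By mixing some iterate maps \<open>{s<..<t}\<close> over a nondegenerate segment
  \<open>{c..d}\<close> inside \<open>b\<close>. Each \<open>z\<close> in it has an additional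
  preimage, so the integral grows by at least \<open>d - c\<close>.\<close>

lemma truncated_variation_strict:
  assumes s: "s \<in> {0..1}" and t: "t \<in> {0..1}" and st: "s < t"
  shows "\<exists>n. truncated_variation b n s < truncated_variation b n t"
proof -
  obtain p q where pq: "p < q" "b = {p<..<q}" "{p..q} \<subseteq> {0..1}"
    using partition_interval_Ioo[OF b] by metis
  have "{s<..<t} \<subseteq> {0..1}" "{p<..<q} \<subseteq> {0..1}"
    using s t partition_interval_subset[OF b] pq(2) by auto
  from eventually_happens[OF mixing_covers_subinterval[OF st this(1) pq(1) this(2)]]
  obtain n c d where cd: "p < c" "c < d" "d < q" "{c..d} \<subseteq> (f ^^ n) ` {s<..<t}"
    by auto
  have "indicator {c..d} z \<le> indicator b z * preimage_count n t z - indicator b z * preimage_count n s z"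
    for z
  proof (cases "z \<in> {c..d}")
    case True
    then have "z \<in> b" using cd pq by auto
    obtain y where "y \<in> {y \<in> {s<..t}. (f ^^ n) y = z}"
      using True cd(4) by force
    moreover have "finite {y \<in> {s<..t}. (f ^^ n) y = z}"
      using s t \<open>z \<in> b\<close> by (intro finite_preimages_subset) auto
    ultimately have "card {y \<in> {s<..t}. (f ^^ n) y = z} \<ge> 1"
      by (metis One_nat_def Suc_leI card_gt_0_iff empty_iff)
    then show ?thesis
      using True \<open>z \<in> b\<close> preimage_count_diff[OF s t less_imp_le[OF st] \<open>z \<in> b\<close>, of n] by simp
  next
    case False
    then show ?thesis
      using preimage_count_diff[OF s t less_imp_le[OF st], of z n] by (cases "z \<in> b") auto
  qed
  then have "(\<integral>z. indicator {c..d} z \<partial>lborel) \<le>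
      (\<integral>z. indicator b z * preimage_count n t z - indicator b z * preimage_count n s z \<partial>lborel)"
    by (intro integral_mono Bochner_Integration.integrable_diff preimage_count_integrable s t)
      (auto intro!: integrable_real_indicator simp: emeasure_lborel_Icc_eq)
  also have "\<dots> = truncated_variation b n t - truncated_variation b n s"
    using truncated_variation_diff[OF s t] by simp
  finally have "d - c \<le> truncated_variation b n t - truncated_variation b n s"
    using cd by simp
  then show ?thesis using cd by (intro exI[of _ n]) simp
qed

text \<open>Summability makes the weighted series converge uniformly, hence continuous; strictness
  of one term for each pair of points makes the sum strictly increasing. The weights
  \<open>L ^ n\<close> turn the passage from \<open>n\<close> to \<open>Suc n\<close> into the
  Lipschitz factor \<open>L\<close>.\<close>

lemma Lipschitz_conjugate:
  assumes "0 < L" and summ: "summable (\<lambda>n. real (card (paths n b)) / L ^ n)"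
  shows "\<exists>\<psi> \<psi>' :: real \<Rightarrow> real. homeomorphism {0..1} {0..1} \<psi> \<psi>' \<and>
    lipschitz_on L {0..1} (\<psi> \<circ> f \<circ> \<psi>')"
proof -
  let ?V = "\<lambda>n t. truncated_variation b n t / L ^ n"
  define \<Phi> where "\<Phi> t = (\<Sum>n. ?V n t)" for t
  have V_norm: "norm (?V n t) \<le> real (card (paths n b)) / L ^ n" if "t \<in> {0..1}" for n t
    using truncated_variation_bounds[OF that, of n] \<open>0 < L\<close> by (simp add: divide_right_mono)
  have V_summable: "summable (\<lambda>n. ?V n t)" if "t \<in> {0..1}" for t
    using summable_comparison_test'[OF summ V_norm[OF that]] .
  have "uniform_limit {0..1} (\<lambda>N t. \<Sum>n<N. ?V n t) \<Phi> sequentially"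
    unfolding \<Phi>_def using V_norm summ by (rule Weierstrass_m_test)
  then have \<Phi>_cont: "continuous_on {0..1} \<Phi>"
    by (rule uniform_limit_theorem[rotated])
      (use \<open>0 < L\<close> in \<open>auto intro!: always_eventually continuous_on_sum continuous_on_divide
         truncated_variation_continuous continuous_on_const\<close>)
  have \<Phi>_diff: "\<Phi> t - \<Phi> s = (\<Sum>n. ?V n t - ?V n s)" if "s \<in> {0..1}" "t \<in> {0..1}" for s t
    unfolding \<Phi>_def by (intro suminf_diff V_summable that)
  have \<Phi>_less: "\<Phi> s < \<Phi> t" if st: "s \<in> {0..1}" "t \<in> {0..1}" "s < t" for s t
  proof -
    obtain n where "truncated_variation b n s < truncated_variation b n t"
      using truncated_variation_strict[OF st] by blast
    then have "0 < ?V n t - ?V n s"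
      using \<open>0 < L\<close> by (simp add: divide_strict_right_mono)
    moreover have "0 \<le> ?V m t - ?V m s" for m
      using truncated_variation_mono[OF st(1,2), of m] st(3) \<open>0 < L\<close> by (simp add: divide_right_mono)
    ultimately have "0 < (\<Sum>n. ?V n t - ?V n s)"
      by (intro suminf_pos2[where i = n] summable_diff V_summable st)
    then show ?thesis
      using \<Phi>_diff[OF st(1,2)] by linarith
  qed
  have \<Phi>_image: "\<bar>\<Phi> (f t) - \<Phi> (f s)\<bar> \<le> L * (\<Phi> t - \<Phi> s)"
    if st: "s \<in> {0..1}" "t \<in> {0..1}" "s \<le> t" for s t
  proof -
    have fs: "f s \<in> {0..1}" and ft: "f t \<in> {0..1}" using st f_in_unit by auto
    \<comment> \<open>Termwise form of the estimate: dividing by \<open>L ^ n\<close> rather than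
      \<open>L ^ Suc n\<close> releases one factor \<open>L\<close>.\<close>
    have le: "\<bar>?V n (f t) - ?V n (f s)\<bar> \<le> L * (?V (Suc n) t - ?V (Suc n) s)" for n
    proof -
      have "\<bar>?V n (f t) - ?V n (f s)\<bar> =
          \<bar>truncated_variation b n (f t) - truncated_variation b n (f s)\<bar> / L ^ n"
        using \<open>0 < L\<close> by (simp add: diff_divide_distrib[symmetric])
      also have "\<dots> \<le> (truncated_variation b (Suc n) t - truncated_variation b (Suc n) s) / L ^ n"
        using truncated_variation_image_le[OF st, of n] \<open>0 < L\<close> by (simp add: divide_right_mono)
      also have "\<dots> = L * (?V (Suc n) t - ?V (Suc n) s)"
        using \<open>0 < L\<close> by (simp add: field_simps)
      finally show ?thesis .
    qed
    have sumd: "summable (\<lambda>n. ?V n t - ?V n s)"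
      by (intro summable_diff V_summable st)
    then have sumS: "summable (\<lambda>n. ?V (Suc n) t - ?V (Suc n) s)"
      by (rule summable_Suc_iff[THEN iffD2])
    then have sumr: "summable (\<lambda>n. L * (?V (Suc n) t - ?V (Suc n) s))"
      by (rule summable_mult)
    then have sumabs: "summable (\<lambda>n. \<bar>?V n (f t) - ?V n (f s)\<bar>)"
      by (rule summable_comparison_test'[where N = 0]) (use le in simp)
    have "\<bar>\<Phi> (f t) - \<Phi> (f s)\<bar> = \<bar>\<Sum>n. ?V n (f t) - ?V n (f s)\<bar>"
      using \<Phi>_diff[OF fs ft] by simp
    also have "\<dots> \<le> (\<Sum>n. \<bar>?V n (f t) - ?V n (f s)\<bar>)"
      using sumabs by (rule summable_rabs)
    also have "\<dots> \<le> (\<Sum>n. L * (?V (Suc n) t - ?V (Suc n) s))"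
      by (rule suminf_le[OF le sumabs sumr])
    also have "\<dots> = L * (\<Sum>n. ?V (Suc n) t - ?V (Suc n) s)"
      using sumS by (rule suminf_mult)
    \<comment> \<open>The shifted series lacks the term for 0, which is nonnegative, so restoring it
      only weakens the bound.\<close>
    also have "(\<Sum>n. ?V (Suc n) t - ?V (Suc n) s) = (\<Sum>n. ?V n t - ?V n s) - (?V 0 t - ?V 0 s)"
      using suminf_split_head[OF sumd] by simp
    also have "\<dots> \<le> (\<Sum>n. ?V n t - ?V n s)"
      using truncated_variation_mono[OF st, of 0] by simp
    also have "\<dots> = \<Phi> t - \<Phi> s"
      using \<Phi>_diff[OF st(1,2)] by simp
    finally show ?thesis using \<open>0 < L\<close> by simp
  qed
  \<comment> \<open>Subtracting \<Phi> at 0 and dividing by \<open>D\<close> makes the homeomorphism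
    fix 0 and 1; the Lipschitz factor is unaffected.\<close>
  define D where "D = \<Phi> 1 - \<Phi> 0"
  have "D > 0" using \<Phi>_less[of 0 1] by (simp add: D_def)
  define \<psi> where "\<psi> t = (\<Phi> t - \<Phi> 0) / D" for t
  have \<psi>_cont: "continuous_on {0..1} \<psi>"
    unfolding \<psi>_def using \<Phi>_cont \<open>D > 0\<close> by (intro continuous_intros) auto
  have \<psi>_less: "\<psi> s < \<psi> t" if "s \<in> {0..1}" "t \<in> {0..1}" "s < t" for s t
    using \<Phi>_less[OF that] \<open>D > 0\<close> by (simp add: \<psi>_def divide_strict_right_mono)
  have ends: "\<psi> 0 = 0" "\<psi> 1 = 1" using \<open>D > 0\<close> by (auto simp: \<psi>_def D_def)
  have "inj_on \<psi> {0..1}"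
    using \<psi>_less by (intro linorder_inj_onI) fastforce+
  moreover have "\<psi> ` {0..1} = {0..1}"
  proof
    show "\<psi> ` {0..1} \<subseteq> {0..1}"
    proof
      fix v assume "v \<in> \<psi> ` {0..1}"
      then obtain u where u: "u \<in> {0..1}" "v = \<psi> u" by blast
      then have "\<psi> 0 \<le> \<psi> u" "\<psi> u \<le> \<psi> 1"
        using \<psi>_less[of 0 u] \<psi>_less[of u 1] by (auto simp: order_le_less)
      then show "v \<in> {0..1}" using ends u by simp
    qed
    have "connected (\<psi> ` {0..1})"
      using \<psi>_cont by (rule connected_continuous_image) simp
    then show "{0..1} \<subseteq> \<psi> ` {0..1}"
      by (rule connected_contains_Icc) (use ends in force)+
  qed
  ultimately obtain \<psi>' where hom: "homeomorphism {0..1} {0..1} \<psi> \<psi>'"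
    using homeomorphism_compact[of "{0..1}" \<psi> "{0..1}"] \<psi>_cont by auto
  have \<psi>_image: "\<bar>\<psi> (f t) - \<psi> (f s)\<bar> \<le> L * \<bar>\<psi> t - \<psi> s\<bar>"
    if st: "s \<in> {0..1}" "t \<in> {0..1}" "s \<le> t" for s t
  proof -
    have "\<bar>\<psi> (f t) - \<psi> (f s)\<bar> = \<bar>\<Phi> (f t) - \<Phi> (f s)\<bar> / D"
      using \<open>D > 0\<close> by (simp add: \<psi>_def diff_divide_distrib[symmetric])
    also have "\<dots> \<le> L * (\<Phi> t - \<Phi> s) / D"
      using \<Phi>_image[OF st] \<open>D > 0\<close> by (simp add: divide_right_mono)
    also have "\<dots> = L * (\<psi> t - \<psi> s)"
      by (simp add: \<psi>_def diff_divide_distrib[symmetric])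
    also have "\<dots> \<le> L * \<bar>\<psi> t - \<psi> s\<bar>" using \<open>0 < L\<close> by simp
    finally show ?thesis .
  qed
  have "lipschitz_on L {0..1} (\<psi> \<circ> f \<circ> \<psi>')"
  proof (rule lipschitz_onI)
    fix u v :: real assume uv: "u \<in> {0..1}" "v \<in> {0..1}"
    have s: "\<psi>' u \<in> {0..1}" "\<psi> (\<psi>' u) = u" and t: "\<psi>' v \<in> {0..1}" "\<psi> (\<psi>' v) = v"
      using hom uv by (auto simp: homeomorphism_def)
    have "\<psi>' u \<le> \<psi>' v \<or> \<psi>' v \<le> \<psi>' u" by linarith
    then have "\<bar>\<psi> (f (\<psi>' u)) - \<psi> (f (\<psi>' v))\<bar> \<le> L * \<bar>\<psi> (\<psi>' u) - \<psi> (\<psi>' v)\<bar>"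
      using \<psi>_image[OF s(1) t(1)] \<psi>_image[OF t(1) s(1)] by (metis abs_minus_commute)
    then show "dist ((\<psi> \<circ> f \<circ> \<psi>') u) ((\<psi> \<circ> f \<circ> \<psi>') v) \<le> L * dist u v"
      using s t by (simp add: dist_real_def)
  qed (use \<open>0 < L\<close> in simp)
  with hom show ?thesis by blast
qed

end

end

section \<open>Growth rates\<close>

text \<open>Common form of the two upper limits in the theorem. The value at \<open>n = 0\<close>,
  where \<open>1 / real n\<close> is 0, does not affect the limit, and a zero count has logarithm
  minus infinity.\<close>

definition growth_rate :: "(nat \<Rightarrow> enat) \<Rightarrow> ereal" where
  "growth_rate a = limsup (\<lambda>n. ereal (1 / real n) * ln_ereal (ereal_of_enat (a n)))"

lemma ln_ereal_simps [simp]: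
  "ln_ereal (ereal 0) = -\<infinity>" "ln_ereal 0 = -\<infinity>" "ln_ereal \<infinity> = \<infinity>" "0 < r \<Longrightarrow> ln_ereal (ereal r) = ereal (ln r)"
  by (auto simp: ln_ereal_def)

lemma growth_rate_le:
  assumes "0 < C" "0 < L" and le: "\<And>n. \<exists>k. a n = enat k \<and> real k \<le> C * L ^ n"
  shows "growth_rate a \<le> ereal (ln L)"
proof -
  have "eventually (\<lambda>n. ereal (1 / real n) * ln_ereal (ereal_of_enat (a n))
      \<le> ereal (ln C / real n + ln L)) sequentially"
    using eventually_gt_at_top[of 0]
  proof eventually_elim
    case (elim n)
    obtain k where k: "a n = enat k" "real k \<le> C * L ^ n" using le by blast
    show ?case
    proof (cases "k = 0")
      case False
      then have "ln (real k) \<le> ln (C * L ^ n)"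
        using k(2) assms(1,2) by (subst ln_le_cancel_iff) auto
      also have "\<dots> = ln C + real n * ln L"
        using assms(1,2) by (simp add: ln_mult ln_realpow)
      finally have "ln (real k) / real n \<le> ln C / real n + ln L"
        using elim by (simp add: field_simps)
      then show ?thesis using False k(1) by simp
    qed (use elim k(1) in simp)
  qed
  then have "growth_rate a \<le> limsup (\<lambda>n. ereal (ln C / real n + ln L))"
    unfolding growth_rate_def by (rule Limsup_mono)
  also have "(\<lambda>n. ln C / real n + ln L) \<longlonglongrightarrow> 0 + ln L"
    by (intro tendsto_add lim_const_over_n tendsto_const)
  then have "(\<lambda>n. ereal (ln C / real n + ln L)) \<longlonglongrightarrow> ereal (ln L)" by simp
  then have "limsup (\<lambda>n. ereal (ln C / real n + ln L)) = ereal (ln L)"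
    by (intro lim_imp_Limsup) simp_all
  finally show ?thesis .
qed

lemma growth_rate_nonneg:
  assumes "eventually (\<lambda>n. a n \<noteq> 0) sequentially"
  shows "0 \<le> growth_rate a"
  unfolding growth_rate_def
proof (rule le_Limsup)
  show "eventually (\<lambda>n. 0 \<le> ereal (1 / real n) * ln_ereal (ereal_of_enat (a n))) sequentially"
    using assms
  proof eventually_elim
    case (elim n)
    then have "0 \<le> ln_ereal (ereal_of_enat (a n))"
      by (cases "a n") (auto simp: zero_enat_def)
    then show ?case by (intro ereal_0_le_mult) simp_all
  qed
qed simp

text \<open>\<open>M\<close> is \<open>exp r\<close> for a real \<open>r\<close> strictly between
  the two rates. The strict gap \<open>M < L\<close> is what later makes a geometric series
  converge.\<close>

lemma growth_rate_lessD:
  assumes "growth_rate a < ereal (ln L)" "0 < L"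
  obtains M where "0 < M" "M < L"
    "eventually (\<lambda>n. \<exists>k. a n = enat k \<and> real k \<le> M ^ n) sequentially"
proof -
  obtain r where r: "growth_rate a < ereal r" "r < ln L"
    using ereal_dense2[OF assms(1)] by auto
  have "exp r < L" using r(2) \<open>0 < L\<close> by (metis exp_less_cancel_iff exp_ln)
  moreover have "eventually (\<lambda>n. \<exists>k. a n = enat k \<and> real k \<le> exp r ^ n) sequentially"
    using Limsup_lessD[OF r(1)[unfolded growth_rate_def]] eventually_gt_at_top[of 0]
  proof eventually_elim
    case (elim n)
    show ?case
    proof (cases "a n")
      case (enat k)
      have "real k \<le> exp r ^ n"
      proof (cases "k = 0")
        case False
        then have "ln (real k) / real n < r" using elim enat by simp
        then have "ln (real k) < real n * r" using elim(2) by (simp add: field_simps)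
        then have "exp (ln (real k)) < exp (real n * r)" by simp
        then show ?thesis using False by (simp add: exp_of_nat_mult)
      qed simp
      then show ?thesis using enat by simp
    next
      case infinity
      then show ?thesis using elim by simp
    qed
  qed
  ultimately show thesis using that[of "exp r"] by simp
qed

text \<open>A constant factor adds \<open>ln K / n\<close>, which tends to 0. Where
  \<open>c n\<close> is infinite the comparison is trivial, so the hypothesis speaks of finite
  values only.\<close>

lemma growth_rate_mono_factor:
  assumes "0 < K" and le: "\<And>n k. c n = enat k \<Longrightarrow> \<exists>j. a n = enat j \<and> j \<le> K * k"
  shows "growth_rate a \<le> growth_rate c"
proof -
  have "eventually (\<lambda>n. ereal (1 / real n) * ln_ereal (ereal_of_enat (a n))
      \<le> ereal (ln (real K) / real n) + ereal (1 / real n) * ln_ereal (ereal_of_enat (c n))) sequentially"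
    using eventually_gt_at_top[of 0]
  proof eventually_elim
    case (elim n)
    show ?case
    proof (cases "c n")
      case (enat k)
      then obtain j where j: "a n = enat j" "j \<le> K * k" using le by blast
      show ?thesis
      proof (cases "j = 0")
        case False
        then have "k \<noteq> 0" using j by (metis le_zero_eq mult_0_right)
        have "ln (real j) \<le> ln (real (K * k))"
          using False j(2) \<open>k \<noteq> 0\<close> \<open>0 < K\<close> by (subst ln_le_cancel_iff) (auto simp del: of_nat_mult)
        also have "\<dots> = ln (real K) + ln (real k)"
          using \<open>k \<noteq> 0\<close> \<open>0 < K\<close> by (simp add: ln_mult)
        finally have "ln (real j) / real n \<le> ln (real K) / real n + ln (real k) / real n"
          using elim by (simp add: field_simps)
        then show ?thesis using False \<open>k \<noteq> 0\<close> j(1) enat by simp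
      qed (use elim j(1) in simp)
    next
      case infinity
      then show ?thesis using elim by simp
    qed
  qed
  then have "growth_rate a \<le> limsup (\<lambda>n. ereal (ln (real K) / real n)
      + ereal (1 / real n) * ln_ereal (ereal_of_enat (c n)))"
    unfolding growth_rate_def by (rule Limsup_mono)
  also have "\<dots> = 0 + limsup (\<lambda>n. ereal (1 / real n) * ln_ereal (ereal_of_enat (c n)))"
  proof (rule ereal_limsup_lim_add)
    show "(\<lambda>n. ereal (ln (real K) / real n)) \<longlonglongrightarrow> 0"
      using lim_const_over_n[of "ln (real K)"] by (simp add: zero_ereal_def)
  qed simp
  finally show ?thesis by (simp add: growth_rate_def)
qed

lemma finite_points_separated:
  fixes Y :: "real set"
  assumes "finite Y"
  obtains d where "d > 0" "\<And>y y'. y \<in> Y \<Longrightarrow> y' \<in> Y \<Longrightarrow> y \<noteq> y' \<Longrightarrow> d \<le> dist y y'"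
proof -
  \<comment> \<open>The element 1 keeps \<open>D\<close> nonempty when \<open>Y\<close> has no two
    distinct points.\<close>
  define D where "D = insert 1 ((\<lambda>(y, y'). dist y y') ` {(y, y') \<in> Y \<times> Y. y \<noteq> y'})"
  have "finite {(y, y') \<in> Y \<times> Y. y \<noteq> y'}"
    using assms by (auto intro: finite_subset[of _ "Y \<times> Y"])
  then have "finite D" by (simp add: D_def)
  then have "Min D \<in> D" by (intro Min_in) (auto simp: D_def)
  then have "Min D > 0" by (auto simp: D_def)
  moreover have "Min D \<le> dist y y'" if "y \<in> Y" "y' \<in> Y" "y \<noteq> y'" for y y'
    using that by (intro Min_le \<open>finite D\<close>) (force simp: D_def)
  ultimately show thesis using that by blast
qed

section \<open>Lipschitz constants of conjugates, path growth and preimage growth\<close>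

context mixing_Markov_map
begin

definition Lipschitz_constants :: "real set" where
  "Lipschitz_constants = {L. \<exists>\<psi> \<psi>' :: real \<Rightarrow> real. homeomorphism {0..1} {0..1} \<psi> \<psi>' \<and>
     lipschitz_on L {0..1} (\<psi> \<circ> f \<circ> \<psi>')}"

lemma Lipschitz_inf_eq: "Lipschitz_inf f = Inf (ereal ` Lipschitz_constants)"
  by (simp add: Lipschitz_inf_def Lipschitz_constants_def setcompr_eq_image)

abbreviation path_count :: "real set \<Rightarrow> nat \<Rightarrow> enat" where
  "path_count b n \<equiv> ecard (paths n b)"

lemma rev_Salama_entropy_eq:
  "rev_Salama_entropy (partition_intervals P) (transition_matrix f) b = growth_rate (path_count b)"
  by (simp add: rev_Salama_entropy_def growth_rate_def)

lemma eventually_path_count_nonzero: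
  assumes b: "b \<in> partition_intervals P"
  shows "eventually (\<lambda>n. path_count b n \<noteq> 0) sequentially"
  using eventually_paths_nonempty[OF b] by eventually_elim (auto simp: ecard_def zero_enat_def)

lemma partition_interval_exists: "\<exists>b. b \<in> partition_intervals P"
proof -
  have "uncountable {0..1::real}" by (simp add: uncountable_closed_interval)
  moreover have "countable P" using partition by (simp add: partition_set_def)
  ultimately have "{0..1} - P \<noteq> {}"
    by (metis Diff_eq_empty_iff countable_subset)
  then show ?thesis using interval_of_in(1) by blast
qed

text \<open>With \<open>L = 0\<close> the bound \<open>C * L ^ n\<close> would forbid paths of
  positive length, but mixing provides them.\<close>

lemma Lipschitz_constants_pos:
  assumes "L \<in> Lipschitz_constants"
  shows "L > 0"
proof -
  obtain \<psi> \<psi>' :: "real \<Rightarrow> real" where \<psi>: "homeomorphism {0..1} {0..1} \<psi> \<psi>'" "lipschitz_on L {0..1} (\<psi> \<circ> f \<circ> \<psi>')"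
    using assms unfolding Lipschitz_constants_def by blast
  have "L \<ge> 0" using \<psi>(2) by (rule lipschitz_on_nonneg)
  moreover have "L \<noteq> 0"
  proof
    assume "L = 0"
    obtain b where b: "b \<in> partition_intervals P" using partition_interval_exists by blast
    obtain C where C: "\<And>n. finite (paths n b)" "\<And>n. real (card (paths n b)) \<le> C * L ^ n"
      using card_paths_le_Lipschitz[OF b \<psi>] by blast
    have "eventually (\<lambda>n. paths n b \<noteq> {} \<and> n > 0) sequentially"
      using eventually_paths_nonempty[OF b] eventually_gt_at_top[of 0] by eventually_elim simp
    then obtain n where "paths n b \<noteq> {}" "n > 0"
      unfolding eventually_sequentially by blast
    then have "0 < real (card (paths n b))" using C(1) by (simp add: card_gt_0_iff)
    also have "\<dots> \<le> 0" using C(2)[of n] \<open>L = 0\<close> \<open>n > 0\<close> by (simp add: power_0_left)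
    finally show False by simp
  qed
  ultimately show ?thesis by simp
qed

lemma growth_rate_le_ln_Lipschitz:
  assumes b: "b \<in> partition_intervals P" and L: "L \<in> Lipschitz_constants"
  shows "growth_rate (path_count b) \<le> ereal (ln L)"
proof -
  obtain \<psi> \<psi>' :: "real \<Rightarrow> real" where \<psi>: "homeomorphism {0..1} {0..1} \<psi> \<psi>'" "lipschitz_on L {0..1} (\<psi> \<circ> f \<circ> \<psi>')"
    using L unfolding Lipschitz_constants_def by blast
  obtain C where "C > 0" "\<And>n. finite (paths n b) \<and> real (card (paths n b)) \<le> C * L ^ n"
    using card_paths_le_Lipschitz[OF b \<psi>] by blast
  then show ?thesis
    using Lipschitz_constants_pos[OF L] by (intro growth_rate_le[of C L]) (auto simp: ecard_def)
qed

text \<open>The growth hypothesis dominates the weighted path counts by a convergent geometric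
  series, as \<open>Lipschitz_conjugate\<close> requires.\<close>

lemma Lipschitz_constants_above:
  assumes b: "b \<in> partition_intervals P" and "0 < L" "growth_rate (path_count b) < ereal (ln L)"
  shows "L \<in> Lipschitz_constants"
proof -
  obtain M where M: "0 < M" "M < L"
    and ev: "eventually (\<lambda>n. \<exists>k. path_count b n = enat k \<and> real k \<le> M ^ n) sequentially"
    by (rule growth_rate_lessD[OF assms(3,2)])
  have bound: "eventually (\<lambda>n. finite (paths n b) \<and> real (card (paths n b)) \<le> M ^ n) sequentially"
    using ev by eventually_elim (auto simp: ecard_def split: if_splits)
  \<comment> \<open>The growth bound gives finiteness for large \<open>m\<close> only. It descends
    to \<open>n \<le> m\<close> because \<open>f ^^ (m - n)\<close> is onto: every preimage of
    \<open>z\<close> under \<open>f ^^ n\<close> is the image of one under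
    \<open>f ^^ m\<close>.\<close>
  have fin: "finite (paths n b)" for n
  proof -
    obtain z where z: "z \<in> b"
      using partition_interval_Ioo[OF b] by (metis dense greaterThanLessThan_iff)
    obtain m where m: "m \<ge> n" "finite (paths m b)"
      using bound unfolding eventually_sequentially by (meson nle_le)
    have pre: "(f ^^ m) y = (f ^^ n) ((f ^^ (m - n)) y)" for y
      using m(1) by (metis comp_apply funpow_add le_add_diff_inverse)
    have "{y \<in> {0..1}. (f ^^ n) y = z} \<subseteq> (f ^^ (m - n)) ` {y \<in> {0..1}. (f ^^ m) y = z}"
    proof clarify
      fix y :: real assume y: "y \<in> {0..1}"
      then obtain y' where "y' \<in> {0..1}" "y = (f ^^ (m - n)) y'"
        using funpow_surj[of "m - n"] by blast
      then show "y \<in> (f ^^ (m - n)) ` {u \<in> {0..1}. (f ^^ m) u = (f ^^ n) y}"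
        using pre by auto
    qed
    moreover have "finite {y \<in> {0..1}. (f ^^ m) y = z}"
      using bij_betw_finite[OF bij_betw_itinerary_paths[OF b z]] m(2) by blast
    ultimately have "finite {y \<in> {0..1}. (f ^^ n) y = z}"
      using finite_subset by blast
    then show ?thesis
      using bij_betw_finite[OF bij_betw_itinerary_paths[OF b z]] by blast
  qed
  have "summable (\<lambda>n. real (card (paths n b)) / L ^ n)"
  proof (rule summable_comparison_test_ev)
    show "eventually (\<lambda>n. norm (real (card (paths n b)) / L ^ n) \<le> (M / L) ^ n) sequentially"
      using bound
      by eventually_elim (use \<open>0 < L\<close> in \<open>simp add: power_divide divide_right_mono\<close>)
    show "summable (\<lambda>n. (M / L) ^ n)"
      using M \<open>0 < L\<close> by (intro summable_geometric) simp
  qed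
  then show ?thesis
    using Lipschitz_conjugate[OF b fin \<open>0 < L\<close>] by (simp add: Lipschitz_constants_def)
qed

text \<open>Every \<open>L\<close> whose logarithm exceeds the growth rate is attained as a
  Lipschitz constant, and none with smaller logarithm is. The left side does not mention
  \<open>b\<close>, so the growth rate is the same for all partition intervals.\<close>

lemma ln_Lipschitz_inf_eq:
  assumes b: "b \<in> partition_intervals P"
  shows "ln_ereal (Lipschitz_inf f) = growth_rate (path_count b)"
proof (cases "growth_rate (path_count b)")
  case (real h)
  have "Lipschitz_inf f = ereal (exp h)"
  proof (rule antisym)
    show "Lipschitz_inf f \<le> ereal (exp h)"
    proof (rule ccontr)
      assume "\<not> ?thesis"
      then obtain r where r: "ereal (exp h) < ereal r" "ereal r < Lipschitz_inf f"
        using ereal_dense2[of "ereal (exp h)" "Lipschitz_inf f"] by (auto simp: not_le)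
      have "0 < r" using r(1) exp_gt_zero[of h] by (simp del: exp_gt_zero)
      moreover have "h < ln r" using r(1) \<open>0 < r\<close> by (metis exp_less_cancel_iff exp_ln less_ereal.simps(1))
      ultimately have "r \<in> Lipschitz_constants"
        by (intro Lipschitz_constants_above[OF b]) (simp_all add: real)
      then have "Lipschitz_inf f \<le> ereal r"
        unfolding Lipschitz_inf_eq by (intro Inf_lower) simp
      with r(2) show False by simp
    qed
    show "ereal (exp h) \<le> Lipschitz_inf f"
      unfolding Lipschitz_inf_eq
    proof (rule Inf_greatest, clarify)
      fix L assume L: "L \<in> Lipschitz_constants"
      have "h \<le> ln L" using growth_rate_le_ln_Lipschitz[OF b L] real by simp
      then show "ereal (exp h) \<le> ereal L"
        using Lipschitz_constants_pos[OF L] by (simp add: ln_ge_iff)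
    qed
  qed
  then show ?thesis using real by (simp add: ln_ereal_def)
next
  case PInf
  \<comment> \<open>Any Lipschitz constant would bound the growth rate by a real number; the infimum
    of the empty set is infinite.\<close>
  then have "Lipschitz_constants = {}"
    using growth_rate_le_ln_Lipschitz[OF b] by force
  then show ?thesis
    using PInf by (simp add: Lipschitz_inf_eq ln_ereal_def top_ereal_def)
next
  case MInf
  then show ?thesis
    using growth_rate_nonneg[OF eventually_path_count_nonzero[OF b]] by simp
qed

section \<open>Preimages of points that are not accumulation points of \<open>P\<close>\<close>

lemma card_preimages_le_off_P:
  assumes L: "L \<in> Lipschitz_constants" and T: "{u<..<v} \<inter> P = {}"
  shows "\<exists>C>0. \<forall>n. \<forall>z\<in>{u<..<v}. finite {y \<in> {0..1}. (f ^^ n) y = z} \<and>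
    real (card {y \<in> {0..1}. (f ^^ n) y = z}) \<le> C * L ^ n"
proof (cases "{u<..<v} \<inter> {0..1} = {}")
  case True
  have empty: "{y \<in> {0..1}. (f ^^ n) y = z} = {}" if "z \<in> {u<..<v}" for n z
    using True that funpow_in_unit by blast
  have "finite {y \<in> {0..1}. (f ^^ n) y = z} \<and> real (card {y \<in> {0..1}. (f ^^ n) y = z}) \<le> 1 * L ^ n"
    if "z \<in> {u<..<v}" for n z
    using Lipschitz_constants_pos[OF L] by (simp only: empty[OF that]) simp
  then show ?thesis using zero_less_one by blast
next
  case False
  then obtain z0 where z0: "z0 \<in> {u<..<v}" "z0 \<in> {0..1}" by blast
  have "{u<..<v} \<subseteq> {0..1} - P"
  proof
    fix z assume z: "z \<in> {u<..<v}"
    \<comment> \<open>An interval that avoids 0 and 1 and meets the unit interval stays inside it,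
      and so lies in a single partition interval.\<close>
    have "0 \<notin> {u<..<v}" "1 \<notin> {u<..<v}"
      using partition T by (auto simp: partition_set_def)
    then have "z \<in> {0..1}" using z z0 by auto
    then show "z \<in> {0..1} - P" using z T by blast
  qed
  moreover from this have "{0..1} - P \<noteq> {}" using z0(1) by blast
  ultimately obtain b where b: "b \<in> partition_intervals P" "{u<..<v} \<subseteq> b"
    using exists_component_superset[OF _ _ connected_Ioo]
    unfolding partition_intervals_def by blast
  obtain \<psi> \<psi>' :: "real \<Rightarrow> real" where \<psi>: "homeomorphism {0..1} {0..1} \<psi> \<psi>'" "lipschitz_on L {0..1} (\<psi> \<circ> f \<circ> \<psi>')"
    using L unfolding Lipschitz_constants_def by blast
  obtain C where C: "C > 0" "\<And>n. finite (paths n b) \<and> real (card (paths n b)) \<le> C * L ^ n"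
    using card_paths_le_Lipschitz[OF b(1) \<psi>] by blast
  have "finite {y \<in> {0..1}. (f ^^ n) y = z} \<and> real (card {y \<in> {0..1}. (f ^^ n) y = z}) \<le> C * L ^ n"
    if "z \<in> {u<..<v}" for n z
    using bij_betw_finite[OF bij_betw_itinerary_paths[OF b(1), of z n]]
      bij_betw_same_card[OF bij_betw_itinerary_paths[OF b(1), of z n]] C(2)[of n] b(2) that by auto
  then show ?thesis using C(1) by blast
qed

text \<open>
  Since \<open>f ^^ n\<close> is not locally constant, near each of finitely many preimages of \<open>x\<close> there is
  a preimage of \<open>x + \<eta>\<close> or of \<open>x - \<eta>\<close>, for one common small \<open>\<eta>\<close>.
\<close>

lemma preimages_perturb:
  assumes Y: "finite Y" "Y \<subseteq> {y \<in> {0..1}. (f ^^ n) y = x}" and "e > 0"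
  obtains \<eta> t where "0 < \<eta>" "\<eta> < e" "inj_on t Y"
    "\<And>y. y \<in> Y \<Longrightarrow> t y \<in> {0..1} \<and> ((f ^^ n) (t y) = x - \<eta> \<or> (f ^^ n) (t y) = x + \<eta>)"
proof -
  \<comment> \<open>Moving each point of \<open>Y\<close> by less than \<open>d / 2\<close> keeps
    the perturbed points distinct.\<close>
  obtain d where d: "d > 0" "\<And>y y'. y \<in> Y \<Longrightarrow> y' \<in> Y \<Longrightarrow> y \<noteq> y' \<Longrightarrow> d \<le> dist y y'"
    using finite_points_separated[OF Y(1)] by metis
  have "\<exists>w. w \<in> {0..1} \<and> \<bar>w - y\<bar> < d / 2 \<and> (f ^^ n) w \<noteq> x" if "y \<in> Y" for y
  proof -
    have "y \<in> {0..1}" using Y(2) that by blast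
    then have "max 0 (y - d / 2) < min 1 (y + d / 2)" using d(1) by auto
    moreover have "{max 0 (y - d / 2)<..<min 1 (y + d / 2)} \<subseteq> {0..1}" by auto
    ultimately obtain w where "w \<in> {max 0 (y - d / 2)<..<min 1 (y + d / 2)}" "(f ^^ n) w \<noteq> x"
      using funpow_not_constant by blast
    moreover from this have "\<bar>w - y\<bar> < d / 2" by (subst abs_less_iff) auto
    ultimately show ?thesis by (intro exI[of _ w]) auto
  qed
  then obtain w where w: "\<And>y. y \<in> Y \<Longrightarrow> w y \<in> {0..1} \<and> \<bar>w y - y\<bar> < d / 2 \<and> (f ^^ n) (w y) \<noteq> x"
    by metis
  define E where "E = insert e ((\<lambda>y. \<bar>(f ^^ n) (w y) - x\<bar>) ` Y)"
  \<comment> \<open>Half the minimum, so that \<eta> is below \<open>e\<close> and below every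
    displacement \<open>\<bar>(f ^^ n) (w y) - x\<bar>\<close>; then one of the two shifted values
    is attained between \<open>y\<close> and \<open>w y\<close>.\<close>
  define \<eta> where "\<eta> = Min E / 2"
  have "finite E" "E \<noteq> {}" using Y(1) by (auto simp: E_def)
  then have "Min E \<in> E" by (rule Min_in)
  then have "Min E > 0" using \<open>e > 0\<close> w by (auto simp: E_def)
  then have "0 < \<eta>" by (simp add: \<eta>_def)
  have less: "\<eta> < r" if "r \<in> E" for r
    using Min_le[OF \<open>finite E\<close> that] \<open>Min E > 0\<close> by (simp add: \<eta>_def)
  have "\<exists>t. t \<in> {0..1} \<and> \<bar>t - y\<bar> < d / 2 \<and> ((f ^^ n) t = x - \<eta> \<or> (f ^^ n) t = x + \<eta>)" if y: "y \<in> Y" for y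
  proof -
    have y01: "y \<in> {0..1}" "(f ^^ n) y = x" using Y(2) y by auto
    have sub: "closed_segment y (w y) \<subseteq> {0..1}"
      using y01 w[OF y] by (auto simp: closed_segment_eq_real_ivl)
    have "connected ((f ^^ n) ` closed_segment y (w y))"
      by (intro connected_continuous_image continuous_on_subset[OF continuous_on_funpow] sub) simp
    then have "closed_segment ((f ^^ n) y) ((f ^^ n) (w y)) \<subseteq> (f ^^ n) ` closed_segment y (w y)"
      by (rule connected_contains_closed_segment) auto
    moreover have "\<eta> < \<bar>(f ^^ n) (w y) - x\<bar>"
      using y by (intro less) (simp add: E_def)
    then have "x - \<eta> \<in> closed_segment ((f ^^ n) y) ((f ^^ n) (w y)) \<or>
        x + \<eta> \<in> closed_segment ((f ^^ n) y) ((f ^^ n) (w y))"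
      using \<open>0 < \<eta>\<close> y01(2) by (auto simp: closed_segment_eq_real_ivl)
    ultimately obtain t where t: "t \<in> closed_segment y (w y)" "(f ^^ n) t = x - \<eta> \<or> (f ^^ n) t = x + \<eta>"
      by auto
    have "\<bar>t - y\<bar> \<le> \<bar>w y - y\<bar>"
      using t(1) by (auto simp: closed_segment_eq_real_ivl split: if_splits)
    then show ?thesis using t w[OF y] sub by (intro exI[of _ t]) auto
  qed
  then obtain t where t: "\<And>y. y \<in> Y \<Longrightarrow> t y \<in> {0..1} \<and> \<bar>t y - y\<bar> < d / 2 \<and>
      ((f ^^ n) (t y) = x - \<eta> \<or> (f ^^ n) (t y) = x + \<eta>)"
    by metis
  have "inj_on t Y"
  proof (rule inj_onI, rule ccontr)
    fix y y' assume y: "y \<in> Y" "y' \<in> Y" "t y = t y'" "y \<noteq> y'"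
    have "\<bar>t y - y\<bar> < d / 2" "\<bar>t y - y'\<bar> < d / 2"
      using t[OF y(1)] t[OF y(2)] y(3) by auto
    moreover have "d \<le> \<bar>y - y'\<bar>" using d(2)[OF y(1,2,4)] by (simp add: dist_real_def)
    ultimately show False by linarith
  qed
  moreover have "\<eta> < e" by (rule less) (simp add: E_def)
  ultimately show thesis using that \<open>0 < \<eta>\<close> t by blast
qed

text \<open>The point \<open>x\<close> may itself belong to \<open>P\<close>, but it has a free
  interval on each side. Preimages of \<open>x\<close> inject into preimages of two nearby points in
  these intervals. The points depend on \<open>n\<close>, the constants \<open>C1\<close> and
  \<open>C2\<close> do not.\<close>

lemma card_preimages_le_Lipschitz:
  assumes L: "L \<in> Lipschitz_constants" and x: "\<not> x islimpt P"
  shows "\<exists>C>0. \<forall>n. finite {y \<in> {0..1}. (f ^^ n) y = x} \<and>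
    real (card {y \<in> {0..1}. (f ^^ n) y = x}) \<le> C * L ^ n"
proof -
  obtain e where e: "e > 0" "\<And>u. u \<in> P \<Longrightarrow> u \<noteq> x \<Longrightarrow> e \<le> dist u x"
    using x unfolding islimpt_approachable by (meson not_le)
  have free: "{x - e<..<x} \<inter> P = {}" "{x<..<x + e} \<inter> P = {}"
    using e(2) by (force simp: dist_real_def)+
  obtain C1 where C1: "C1 > 0" "\<And>n z. z \<in> {x - e<..<x} \<Longrightarrow> finite {y \<in> {0..1}. (f ^^ n) y = z} \<and>
      real (card {y \<in> {0..1}. (f ^^ n) y = z}) \<le> C1 * L ^ n"
    using card_preimages_le_off_P[OF L free(1)] by blast
  obtain C2 where C2: "C2 > 0" "\<And>n z. z \<in> {x<..<x + e} \<Longrightarrow> finite {y \<in> {0..1}. (f ^^ n) y = z} \<and>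
      real (card {y \<in> {0..1}. (f ^^ n) y = z}) \<le> C2 * L ^ n"
    using card_preimages_le_off_P[OF L free(2)] by blast
  have bound: "real (card Y) \<le> (C1 + C2) * L ^ n"
    if Y: "finite Y" "Y \<subseteq> {y \<in> {0..1}. (f ^^ n) y = x}" for Y n
  proof -
    obtain \<eta> t where \<eta>: "0 < \<eta>" "\<eta> < e" and t: "inj_on t Y"
      "\<And>y. y \<in> Y \<Longrightarrow> t y \<in> {0..1} \<and> ((f ^^ n) (t y) = x - \<eta> \<or> (f ^^ n) (t y) = x + \<eta>)"
      using preimages_perturb[OF Y e(1)] by metis
    let ?A = "{y \<in> {0..1}. (f ^^ n) y = x - \<eta>}" and ?B = "{y \<in> {0..1}. (f ^^ n) y = x + \<eta>}"
    have A: "finite ?A" "real (card ?A) \<le> C1 * L ^ n" using C1(2)[of "x - \<eta>" n] \<eta> by auto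
    have B: "finite ?B" "real (card ?B) \<le> C2 * L ^ n" using C2(2)[of "x + \<eta>" n] \<eta> by auto
    have "card Y \<le> card (?A \<union> ?B)"
      using A(1) B(1) t by (intro card_inj_on_le[of t]) auto
    also have "\<dots> \<le> card ?A + card ?B" by (rule card_Un_le)
    finally have "real (card Y) \<le> real (card ?A) + real (card ?B)"
      by (simp flip: of_nat_add)
    then show ?thesis using A(2) B(2) by (simp add: distrib_right)
  qed
  have "finite {y \<in> {0..1}. (f ^^ n) y = x}" for n
  proof (rule finite_if_finite_subsets_card_bdd[THEN conjunct1])
    fix Y assume "Y \<subseteq> {y \<in> {0..1}. (f ^^ n) y = x}" "finite Y"
    then show "card Y \<le> nat \<lfloor>(C1 + C2) * L ^ n\<rfloor>" using bound by (intro le_nat_floor) blast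
  qed
  then show ?thesis
    using bound C1(1) C2(1) by (intro exI[of _ "C1 + C2"]) auto
qed

lemma adjacent_partition_interval:
  assumes "x \<in> {0..1}" and x: "\<not> x islimpt P"
  shows "\<exists>b\<in>partition_intervals P. x \<in> closure b"
proof -
  obtain e where e: "e > 0" "\<And>u. u \<in> P \<Longrightarrow> u \<noteq> x \<Longrightarrow> e \<le> dist u x"
    using x unfolding islimpt_approachable by (meson not_le)
  have free: "{x - e<..<x} \<inter> P = {}" "{x<..<x + e} \<inter> P = {}"
    using e(2) by (force simp: dist_real_def)+
  have "\<exists>u v. u < v \<and> {u<..<v} \<subseteq> {0..1} - P \<and> x \<in> {u..v}"
  \<comment> \<open>The interval is taken to the right of \<open>x\<close>, except at
    \<open>x = 1\<close>, where it must be to the left.\<close>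
  proof (cases "x < 1")
    case True
    have "{x<..<min 1 (x + e)} \<subseteq> {0..1} - P" using assms(1) free(2) by auto
    then show ?thesis using True e(1) by (intro exI[of _ x] exI[of _ "min 1 (x + e)"]) auto
  next
    case False
    have "{max 0 (x - e)<..<x} \<subseteq> {0..1} - P" using assms(1) free(1) by auto
    then show ?thesis using False assms(1) e(1)
      by (intro exI[of _ "max 0 (x - e)"] exI[of _ x]) auto
  qed
  then obtain u v where uv: "u < v" "{u<..<v} \<subseteq> {0..1} - P" "x \<in> {u..v}" by blast
  have "{u<..<v} \<noteq> {}" using uv(1) by simp
  then have "{0..1} - P \<noteq> {}" using uv(2) by blast
  then obtain b where b: "b \<in> partition_intervals P" "{u<..<v} \<subseteq> b"
    using exists_component_superset[OF uv(2) _ connected_Ioo]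
    unfolding partition_intervals_def by blast
  have "closure {u<..<v} \<subseteq> closure b" using b(2) by (rule closure_mono)
  then show ?thesis using uv b(1) by auto
qed

text \<open>For the upper bound, each real \<open>r\<close> above the path growth makes
  \<open>exp r\<close> a Lipschitz constant, which bounds the preimages too. For the lower bound,
  paths ending in an interval adjacent to \<open>x\<close> number at most three times the
  preimages.\<close>

lemma growth_rate_preimages_eq:
  assumes b: "b \<in> partition_intervals P" and x: "x \<in> {0..1}" "\<not> x islimpt P"
  shows "growth_rate (\<lambda>n. ecard {y \<in> {0..1}. (f ^^ n) y = x}) = growth_rate (path_count b)"
proof (rule antisym)
  show "growth_rate (\<lambda>n. ecard {y \<in> {0..1}. (f ^^ n) y = x}) \<le> growth_rate (path_count b)"
  proof (rule ccontr)
    assume "\<not> ?thesis"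
    then obtain r where r: "growth_rate (path_count b) < ereal r"
      "ereal r < growth_rate (\<lambda>n. ecard {y \<in> {0..1}. (f ^^ n) y = x})"
      using ereal_dense2[of "growth_rate (path_count b)"] by (auto simp: not_le)
    have L: "exp r \<in> Lipschitz_constants"
      using r(1) by (intro Lipschitz_constants_above[OF b]) simp_all
    obtain C where "C > 0" "\<And>n. finite {y \<in> {0..1}. (f ^^ n) y = x} \<and>
        real (card {y \<in> {0..1}. (f ^^ n) y = x}) \<le> C * exp r ^ n"
      using card_preimages_le_Lipschitz[OF L x(2)] by blast
    then have "growth_rate (\<lambda>n. ecard {y \<in> {0..1}. (f ^^ n) y = x}) \<le> ereal (ln (exp r))"
      by (intro growth_rate_le[of C]) (auto simp: ecard_def)
    with r(2) show False by simp
  qed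
  obtain b' where b': "b' \<in> partition_intervals P" "x \<in> closure b'"
    using adjacent_partition_interval[OF x] by blast
  \<comment> \<open>The given \<open>b\<close> need not be adjacent to \<open>x\<close>; both rates
    are the logarithm of the same infimum.\<close>
  have "growth_rate (path_count b) = growth_rate (path_count b')"
    using ln_Lipschitz_inf_eq[OF b] ln_Lipschitz_inf_eq[OF b'(1)] by simp
  also have "\<dots> \<le> growth_rate (\<lambda>n. ecard {y \<in> {0..1}. (f ^^ n) y = x})"
  proof (rule growth_rate_mono_factor[of 3])
    fix n k assume "ecard {y \<in> {0..1}. (f ^^ n) y = x} = enat k"
    then have "finite {y \<in> {0..1}. (f ^^ n) y = x}" "card {y \<in> {0..1}. (f ^^ n) y = x} = k"
      by (auto simp: ecard_def split: if_splits)
    then show "\<exists>j. path_count b' n = enat j \<and> j \<le> 3 * k"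
      using card_paths_le_preimages[OF b'] by (auto simp: ecard_def)
  qed simp
  finally show "growth_rate (path_count b) \<le> growth_rate (\<lambda>n. ecard {y \<in> {0..1}. (f ^^ n) y = x})" .
qed

end

theorem theorem4p17:
  fixes f :: "real \<Rightarrow> real" and P :: "real set" and b :: "real set" and x :: real
  assumes "continuous_on {0..1} f" and "f ` {0..1} \<subseteq> {0..1}"
    and "topologically_mixing f"
    and "countably_Markov f" and "partition_set f P"
    and "b \<in> partition_intervals P"
    and "x \<in> {0..1} - {y. y islimpt P}"
  shows "ln_ereal (Lipschitz_inf f)
           = rev_Salama_entropy (partition_intervals P) (transition_matrix f) b \<and>
         rev_Salama_entropy (partition_intervals P) (transition_matrix f) b
           = limsup (\<lambda>n. ereal (1 / real n) *
               ln_ereal (ereal_of_enat (ecard {y\<in>{0..1}. (f ^^ n) y = x})))"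
proof -
  interpret mixing_Markov_map f P
    using assms by unfold_locales
  show ?thesis
    using ln_Lipschitz_inf_eq[OF assms(6)] growth_rate_preimages_eq[OF assms(6), of x] assms(7)
    by (simp add: rev_Salama_entropy_eq) (simp add: growth_rate_def)
qed

end
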